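(* Let $p\in(1,\infty)$, $k\in\mathbb{N}_0$, $\mathsf{bc}\in\{\mathrm{Dir},\mathrm{Neu}\}$, $\gamma\in(-1,(k-k_{\mathsf{bc}})p-1)\setminus\{jp-1:j\in\mathbb{N}_1\}$ and let $X\neq\{0\}$ be a $\mathrm{UMD}$ Banach space. Let $\Delta_{\mathsf{bc}}$ be the Laplacian on $W^{k,p}(\mathbb{R}_+,w_\gamma;X)$ with domain $$D(\Delta_{\mathsf{bc}}):=W^{k+2,p}_{\mathsf{bc}}(\mathbb{R}_+,w_\gamma;X)=\{u\in W^{k+2,p}(\mathbb{R}_+,w_\gamma;X):\mathrm{Tr}\,\partial_x^{k_{\mathsf{bc}}}u=0\}.$$ Then for every $\lambda>0$, the operator $\lambda-\Delta_{\mathsf{bc}}$ is not sectorial.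
   Context: $\mathbb{N}_0$, $\mathbb{N}_1$ denote the natural numbers starting at $0$, $1$; $\mathbb{R}_+=(0,\infty)$; $k_{\mathrm{Dir}}:=0$ and $k_{\mathrm{Neu}}:=1$. For $\gamma>-1$, $w_\gamma(x)=|x|^\gamma$ on $\mathbb{R}_+$; $L^p(\mathbb{R}_+,w_\gamma;X)$ is the space of strongly measurable $f:\mathbb{R}_+\to X$ with $\int_0^\infty\|f(x)\|_X^px^\gamma\,dx<\infty$, and $W^{k,p}(\mathbb{R}_+,w_\gamma;X)$ is the space of $X$-valued distributions on $\mathbb{R}_+$ all of whose derivatives of order $\le k$ lie in $L^p(\mathbb{R}_+,w_\gamma;X)$, with its canonical norm. $\mathrm{Tr}\,g=g(0)$ is the trace at $0$, and $\Delta_{\mathsf{bc}}u=\partial_x^2u$. For $\omega\in(0,\pi)$ let $\Sigma_\omega=\{z\in\mathbb{C}\setminus\{0\}:|\arg z|<\omega\}$. An injective closed linear operator $A$ with dense domain and dense range on a Banach space $Y$ is sectorial if there is $\omega\in(0,\pi)$ with $\sigma(A)\subseteq\overline{\Sigma_\omega}$ and $\sup_{\lambda\in\mathbb{C}\setminus\overline{\Sigma_\omega}}\|\lambda(\lambda-A)^{-1}\|<\infty$. *)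

theory Defs
  imports "HOL-Probability.Probability" "HOL-Library.Function_Algebras"
begin

section \<open>Complex Banach spaces\<close>

class complex_vector = ab_group_add +
  fixes scaleC :: "complex \<Rightarrow> 'a \<Rightarrow> 'a" (infixr \<open>*\<^sub>C\<close> 75)
  assumes scaleC_add_right: "c *\<^sub>C (x + y) = c *\<^sub>C x + c *\<^sub>C y"
    and scaleC_add_left: "(c + d) *\<^sub>C x = c *\<^sub>C x + d *\<^sub>C x"
    and scaleC_scaleC: "c *\<^sub>C d *\<^sub>C x = (c * d) *\<^sub>C x"
    and scaleC_one: "1 *\<^sub>C x = x"

class complex_banach = complex_vector + banach +
  assumes scaleC_of_real: "complex_of_real r *\<^sub>C x = r *\<^sub>R x"
    and norm_scaleC: "norm (c *\<^sub>C x) = cmod c * norm x"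

instantiation "fun" :: (type, complex_vector) complex_vector
begin

definition scaleC_fun :: "complex \<Rightarrow> ('a \<Rightarrow> 'b) \<Rightarrow> 'a \<Rightarrow> 'b"
  where "scaleC_fun c T = (\<lambda>x. c *\<^sub>C T x)"

instance
  by standard (auto simp: scaleC_fun_def plus_fun_def scaleC_add_right scaleC_add_left
    scaleC_scaleC scaleC_one)

end

instantiation complex :: complex_banach
begin

definition scaleC_complex :: "complex \<Rightarrow> complex \<Rightarrow> complex"
  where "scaleC_complex c x = c * x"

instance
  by standard (auto simp: scaleC_complex_def algebra_simps norm_mult scaleR_conv_of_real)

end


section \<open>Strong measurability, Bochner integral and $L^p$ spaces\<close>

text \<open>The library's Bochner integral requires a second countable codomain. The following
  notions are available for arbitrary, possibly non-separable, Banach spaces; they repeat the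
  library definition with Borel measurability replaced by strong measurability.\<close>

definition strongly_measurable :: "'s measure \<Rightarrow> ('s \<Rightarrow> 'a::banach) \<Rightarrow> bool" where
  "strongly_measurable M f \<longleftrightarrow>
    (\<exists>s. (\<forall>i. simple_function M (s i)) \<and> (\<forall>x\<in>space M. (\<lambda>i::nat. s i x) \<longlonglongrightarrow> f x))"

definition has_bochner_int :: "'s measure \<Rightarrow> ('s \<Rightarrow> 'a::banach) \<Rightarrow> 'a \<Rightarrow> bool" where
  "has_bochner_int M f y \<longleftrightarrow> strongly_measurable M f \<and>
    (\<exists>s. (\<forall>i. Bochner_Integration.simple_bochner_integrable M (s i)) \<and>
      (\<lambda>i::nat. \<integral>\<^sup>+x. ennreal (norm (f x - s i x)) \<partial>M) \<longlonglongrightarrow> 0 \<and>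
      (\<lambda>i. Bochner_Integration.simple_bochner_integral M (s i)) \<longlonglongrightarrow> y)"

definition bochner_int :: "'s measure \<Rightarrow> ('s \<Rightarrow> 'a::banach) \<Rightarrow> 'a" where
  "bochner_int M f =
    (if \<exists>y. has_bochner_int M f y then THE y. has_bochner_int M f y else 0)"

definition Lp_space :: "'s measure \<Rightarrow> real \<Rightarrow> ('s \<Rightarrow> 'a::banach) set" where
  "Lp_space M p =
    {f. strongly_measurable M f \<and> (\<integral>\<^sup>+x. ennreal (norm (f x) powr p) \<partial>M) < \<infinity>}"

definition Lp_norm :: "'s measure \<Rightarrow> real \<Rightarrow> ('s \<Rightarrow> 'a::banach) \<Rightarrow> real" where
  "Lp_norm M p f = enn2real (\<integral>\<^sup>+x. ennreal (norm (f x) powr p) \<partial>M) powr (1 / p)"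


section \<open>UMD spaces\<close>

text \<open>The identity \<open>f n = E(f (n+1) | F n)\<close> is expressed by its defining property on the
  sets of finite measure in \<open>F n\<close>.\<close>

definition Lp_martingale ::
  "'s measure \<Rightarrow> real \<Rightarrow> nat \<Rightarrow> (nat \<Rightarrow> 's measure) \<Rightarrow> (nat \<Rightarrow> 's \<Rightarrow> 'a::banach) \<Rightarrow> bool" where
  "Lp_martingale M p N F f \<longleftrightarrow>
    (\<forall>n\<le>N. sigma_finite_subalgebra M (F n) \<and>
      strongly_measurable (F n) (f n) \<and> f n \<in> Lp_space M p) \<and>
    (\<forall>n<N. sets (F n) \<subseteq> sets (F (Suc n)) \<and>
      (\<forall>A\<in>sets (F n). emeasure M A < \<infinity> \<longrightarrow>
        bochner_int M (\<lambda>x. indicator A x *\<^sub>R f (Suc n) x) =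
        bochner_int M (\<lambda>x. indicator A x *\<^sub>R f n x)))"

text \<open>HOL cannot quantify over the type underlying the measure space, so the sigma-finite
  measure spaces range over those whose carrier is a set of real numbers. Nothing is lost: the
  UMD property is already determined by Paley-Walsh martingales, which live on finite
  probability spaces.\<close>

definition UMD :: "'a::complex_banach itself \<Rightarrow> bool" where
  "UMD (_ :: 'a itself) \<longleftrightarrow>
    (\<forall>p>1. \<exists>\<beta>\<ge>0. \<forall>(M :: real measure) N F (f :: nat \<Rightarrow> real \<Rightarrow> 'a) (\<epsilon> :: nat \<Rightarrow> complex).
      sigma_finite_measure M \<and> Lp_martingale M p N F f \<and> (\<forall>n. cmod (\<epsilon> n) = 1) \<longrightarrow>
      Lp_norm M p (\<lambda>x. \<Sum>n<N. \<epsilon> n *\<^sub>C (f (Suc n) x - f n x))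
        \<le> \<beta> * Lp_norm M p (\<lambda>x. \<Sum>n<N. f (Suc n) x - f n x))"


section \<open>Distributions and weighted Sobolev spaces on the half line\<close>

text \<open>Real-valued test functions suffice: a complex-linear distribution on complex-valued test
  functions is the unique complex-linear extension of its restriction to the real-valued ones.\<close>

typedef test_fun =
  "{\<phi> :: real \<Rightarrow> real. (\<forall>n x. (deriv ^^ n) \<phi> field_differentiable (at x)) \<and>
     (\<exists>a>0. \<exists>b. \<forall>x. x \<notin> {a..b} \<longrightarrow> \<phi> x = 0)}"
  morphisms test_apply Abs_test_fun
proof
  have "(deriv ^^ n) (\<lambda>_. 0) = (\<lambda>_ :: real. 0 :: real)" for n
    by (induction n) auto
  then show "(\<lambda>_. 0) \<in> {\<phi> :: real \<Rightarrow> real.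
      (\<forall>n x. (deriv ^^ n) \<phi> field_differentiable (at x)) \<and>
      (\<exists>a>0. \<exists>b. \<forall>x. x \<notin> {a..b} \<longrightarrow> \<phi> x = 0)}"
    by (auto intro: exI[of _ 1])
qed

setup_lifting type_definition_test_fun

lift_definition test_deriv :: "test_fun \<Rightarrow> test_fun" is deriv
proof -
  fix \<phi> :: "real \<Rightarrow> real"
  assume *: "(\<forall>n x. (deriv ^^ n) \<phi> field_differentiable (at x)) \<and>
     (\<exists>a>0. \<exists>b. \<forall>x. x \<notin> {a..b} \<longrightarrow> \<phi> x = 0)"
  then obtain a b where ab: "a > 0" "\<forall>x. x \<notin> {a..b} \<longrightarrow> \<phi> x = 0"
    by blast
  have "deriv \<phi> x = 0" if "x \<notin> {a..b}" for x
  proof -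
    have "eventually (\<lambda>y. y \<in> - {a..b}) (nhds x)"
      using that by (intro eventually_nhds_in_open) auto
    then have "eventually (\<lambda>y. \<phi> y = 0) (nhds x)"
      by (rule eventually_mono) (use ab in auto)
    then have "deriv \<phi> x = deriv (\<lambda>_. 0) x"
      by (intro deriv_cong_ev) auto
    then show ?thesis
      by simp
  qed
  moreover have "(deriv ^^ n) (deriv \<phi>) field_differentiable (at x)" for n x
    using * by (metis comp_apply funpow_Suc_right)
  ultimately show "(\<forall>n x. (deriv ^^ n) (deriv \<phi>) field_differentiable (at x)) \<and>
     (\<exists>a>0. \<exists>b. \<forall>x. x \<notin> {a..b} \<longrightarrow> deriv \<phi> x = 0)"
    using ab by blast
qed

text \<open>Linearity and continuity of a distribution are not part of this type. They are automatic
  for the elements of the Sobolev spaces below, which are regular distributions.\<close>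

type_synonym 'a distr = "test_fun \<Rightarrow> 'a"

definition regular_distr :: "(real \<Rightarrow> 'a::banach) \<Rightarrow> 'a distr" where
  "regular_distr f = (\<lambda>\<phi>. bochner_int (lebesgue_on {0<..}) (\<lambda>x. test_apply \<phi> x *\<^sub>R f x))"

definition distr_deriv :: "'a::banach distr \<Rightarrow> 'a distr" where
  "distr_deriv T = (\<lambda>\<phi>. - T (test_deriv \<phi>))"

definition half_line_measure :: "real \<Rightarrow> real measure" where
  "half_line_measure \<gamma> = density (lebesgue_on {0<..}) (\<lambda>x. ennreal (\<bar>x\<bar> powr \<gamma>))"

definition sobolev :: "nat \<Rightarrow> real \<Rightarrow> real \<Rightarrow> 'a::banach distr set" where
  "sobolev k p \<gamma> =
    {T. \<forall>j\<le>k. \<exists>f\<in>Lp_space (half_line_measure \<gamma>) p. (distr_deriv ^^ j) T = regular_distr f}"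

text \<open>The representing function is unique almost everywhere, hence the choice is immaterial.\<close>

definition distr_Lp_norm :: "real \<Rightarrow> real \<Rightarrow> 'a::banach distr \<Rightarrow> real" where
  "distr_Lp_norm p \<gamma> T = Lp_norm (half_line_measure \<gamma>) p
    (SOME f. f \<in> Lp_space (half_line_measure \<gamma>) p \<and> T = regular_distr f)"

definition sobolev_norm :: "nat \<Rightarrow> real \<Rightarrow> real \<Rightarrow> 'a::banach distr \<Rightarrow> real" where
  "sobolev_norm k p \<gamma> T = (\<Sum>j\<le>k. distr_Lp_norm p \<gamma> ((distr_deriv ^^ j) T))"

text \<open>The trace at \<open>0\<close> is the value at \<open>0\<close> of the representative that is continuous on the
  closed half line.\<close>

definition has_trace :: "'a::banach distr \<Rightarrow> 'a \<Rightarrow> bool" where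
  "has_trace T y \<longleftrightarrow> (\<exists>g. continuous_on {0..} g \<and> T = regular_distr g \<and> g 0 = y)"

datatype bc = Dir | Neu

fun k_bc :: "bc \<Rightarrow> nat" where
  "k_bc Dir = 0"
| "k_bc Neu = 1"

definition sobolev_bc :: "bc \<Rightarrow> nat \<Rightarrow> real \<Rightarrow> real \<Rightarrow> 'a::banach distr set" where
  "sobolev_bc bc m p \<gamma> = {T \<in> sobolev m p \<gamma>. has_trace ((distr_deriv ^^ k_bc bc) T) 0}"

definition laplacian :: "'a::banach distr \<Rightarrow> 'a distr" where
  "laplacian T = (distr_deriv ^^ 2) T"


section \<open>Sectorial operators\<close>

text \<open>A normed space is given by a complex subspace \<open>Y\<close> of an ambient vector space and a
  function \<open>N\<close> that is a norm on \<open>Y\<close>; an unbounded operator by its domain \<open>D\<close> and a function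
  \<open>A\<close>, of which only the values on \<open>D\<close> matter.\<close>

definition linear_operator ::
  "'b::complex_vector set \<Rightarrow> 'b set \<Rightarrow> ('b \<Rightarrow> 'b) \<Rightarrow> bool" where
  "linear_operator Y D A \<longleftrightarrow> module.subspace scaleC D \<and> D \<subseteq> Y \<and> A ` D \<subseteq> Y \<and>
    (\<forall>u\<in>D. \<forall>v\<in>D. A (u + v) = A u + A v) \<and> (\<forall>c. \<forall>u\<in>D. A (c *\<^sub>C u) = c *\<^sub>C A u)"

definition closed_operator ::
  "'b::complex_vector set \<Rightarrow> ('b \<Rightarrow> real) \<Rightarrow> 'b set \<Rightarrow> ('b \<Rightarrow> 'b) \<Rightarrow> bool" where
  "closed_operator Y N D A \<longleftrightarrow>
    (\<forall>s. \<forall>u\<in>Y. \<forall>v\<in>Y. (\<forall>i::nat. s i \<in> D) \<and> (\<lambda>i. N (s i - u)) \<longlonglongrightarrow> 0 \<and>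
      (\<lambda>i. N (A (s i) - v)) \<longlonglongrightarrow> 0 \<longrightarrow> u \<in> D \<and> A u = v)"

definition dense_in :: "'b::complex_vector set \<Rightarrow> ('b \<Rightarrow> real) \<Rightarrow> 'b set \<Rightarrow> bool" where
  "dense_in Y N S \<longleftrightarrow> S \<subseteq> Y \<and> (\<forall>y\<in>Y. \<forall>e>0. \<exists>s\<in>S. N (y - s) < e)"

definition resolvent ::
  "'b::complex_vector set \<Rightarrow> ('b \<Rightarrow> 'b) \<Rightarrow> complex \<Rightarrow> 'b \<Rightarrow> 'b" where
  "resolvent D A z = inv_into D (\<lambda>u. z *\<^sub>C u - A u)"

definition resolvent_set ::
  "'b::complex_vector set \<Rightarrow> ('b \<Rightarrow> real) \<Rightarrow> 'b set \<Rightarrow> ('b \<Rightarrow> 'b) \<Rightarrow> complex set" where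
  "resolvent_set Y N D A = {z. bij_betw (\<lambda>u. z *\<^sub>C u - A u) D Y \<and>
    (\<exists>C. \<forall>y\<in>Y. N (resolvent D A z y) \<le> C * N y)}"

definition spectrum ::
  "'b::complex_vector set \<Rightarrow> ('b \<Rightarrow> real) \<Rightarrow> 'b set \<Rightarrow> ('b \<Rightarrow> 'b) \<Rightarrow> complex set" where
  "spectrum Y N D A = - resolvent_set Y N D A"

definition sector :: "real \<Rightarrow> complex set" where
  "sector \<omega> = {z. z \<noteq> 0 \<and> \<bar>Arg z\<bar> < \<omega>}"

definition sectorial ::
  "'b::complex_vector set \<Rightarrow> ('b \<Rightarrow> real) \<Rightarrow> 'b set \<Rightarrow> ('b \<Rightarrow> 'b) \<Rightarrow> bool" where
  "sectorial Y N D A \<longleftrightarrow>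
    linear_operator Y D A \<and> inj_on A D \<and> closed_operator Y N D A \<and>
    dense_in Y N D \<and> dense_in Y N (A ` D) \<and>
    (\<exists>\<omega>. 0 < \<omega> \<and> \<omega> < pi \<and> spectrum Y N D A \<subseteq> closure (sector \<omega>) \<and>
      (\<exists>C. \<forall>z. z \<notin> closure (sector \<omega>) \<longrightarrow>
        (\<forall>y\<in>Y. N (z *\<^sub>C resolvent D A z y) \<le> C * N y)))"

end

theory Submission
  imports Defs "HOL-Computational_Algebra.Polynomial"
begin

text \<open>
  The operator is not sectorial because it is not densely defined. Since
  \<open>\<gamma> + 1 < (k - k_bc) p\<close>, the trace \<open>u \<mapsto> Tr (\<partial>^k_bc u)\<close> is bounded already on
  \<open>W^{k,p}\<close>, the space in which the operator acts. The boundary condition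
  puts the domain into the kernel of this functional, while \<open>u(x) = exp(-x) c\<close> with \<open>c \<noteq> 0\<close>
  lies in \<open>W^{k,p}\<close> and has trace \<open>c\<close> or \<open>-c\<close>. So \<open>u\<close> has positive distance from the domain
  (\<open>sobolev_bc_not_dense\<close>).

  Boundedness of the trace comes from Taylor's formula. Let \<open>m = k - k_bc \<ge> 1\<close>, let \<open>v\<close> be
  the derivative of order \<open>k_bc\<close> of \<open>u\<close>, and let \<open>\<chi>\<close> be a cutoff with \<open>\<chi> = 1\<close> near \<open>0\<close>; then
  \<open>v(0)\<close> is, up to a factor, the integral of \<open>t^(m-1) (\<chi> v)^(m)(t)\<close>, and \<open>t^(m-1)\<close> pairs boundedly with
  \<open>L^p(w_\<gamma>)\<close> near \<open>0\<close> exactly when \<open>\<gamma> + 1 < m p\<close>. The proof follows this formula on the side of the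
  test functions. If \<open>\<rho>\<close> is a nonnegative bump of mass \<open>1\<close> that concentrates at \<open>0\<close>, then \<open>v(\<rho>)\<close>
  approximates the trace, so a bound on \<open>v(\<rho>)\<close> is needed that does not depend on \<open>\<rho>\<close>. Fix a bump
  \<open>\<theta>\<close> of mass \<open>1\<close> on \<open>[1/2, 1]\<close>. A test function on \<open>(0, 1]\<close>
  is a multiple of \<open>\<theta>\<close> plus the derivative of another test function on \<open>(0, 1]\<close>
  (\<open>test_fun_decomposition\<close>), and each such integration gains one power of \<open>x\<close> in the bound at \<open>0\<close>,
  beginning with the mass bound on \<open>\<rho>\<close>. After \<open>m\<close> integrations the test function is dominated
  by \<open>x^(m-1)\<close>, with a constant that does not depend on \<open>\<rho>\<close>; it is paired with the \<open>m\<close>-th derivative of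
  \<open>v\<close> (\<open>norm_regular_distr_le_Lp_norm\<close>), and the multiples of \<open>\<theta>\<close> are paired with the lower ones. This is
  the induction \<open>norm_distr_le_Lp_norms\<close>, and \<open>sobolev_trace_bound\<close> is its consequence for bumps.
\<close>

section \<open>The Bochner integral of strongly measurable functions\<close>

abbreviation simple_integrable :: "'s measure \<Rightarrow> ('s \<Rightarrow> 'a::banach) \<Rightarrow> bool" where
  "simple_integrable \<equiv> Bochner_Integration.simple_bochner_integrable"

abbreviation simple_integral :: "'s measure \<Rightarrow> ('s \<Rightarrow> 'a::banach) \<Rightarrow> 'a" where
  "simple_integral \<equiv> Bochner_Integration.simple_bochner_integral"

lemma strongly_measurable_compose2:
  fixes h :: "'a::banach \<Rightarrow> 'b::banach \<Rightarrow> 'c::banach"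
  assumes "strongly_measurable M f" "strongly_measurable M g"
    and h: "continuous_on UNIV (\<lambda>(a, b). h a b)"
  shows "strongly_measurable M (\<lambda>x. h (f x) (g x))"
proof -
  obtain s t where s: "\<And>i::nat. simple_function M (s i)"
      "\<And>x. x \<in> space M \<Longrightarrow> (\<lambda>i. s i x) \<longlonglongrightarrow> f x"
    and t: "\<And>i::nat. simple_function M (t i)"
      "\<And>x. x \<in> space M \<Longrightarrow> (\<lambda>i. t i x) \<longlonglongrightarrow> g x"
    using assms(1,2) unfolding strongly_measurable_def by metis
  have "(\<lambda>i. h (s i x) (t i x)) \<longlonglongrightarrow> h (f x) (g x)" if "x \<in> space M" for x
  proof -
    have "(\<lambda>i. case_prod h (s i x, t i x)) \<longlonglongrightarrow> case_prod h (f x, g x)"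
      by (rule continuous_on_tendsto_compose[OF h])
        (auto intro!: tendsto_Pair s t that)
    then show ?thesis by simp
  qed
  moreover have "simple_function M (\<lambda>x. h (s i x) (t i x))" for i
    by (rule simple_function_compose2[OF s(1)[of i] t(1)[of i]])
  ultimately show ?thesis
    unfolding strongly_measurable_def by (intro exI[of _ "\<lambda>i x. h (s i x) (t i x)"]) auto
qed

lemma strongly_measurable_const: "strongly_measurable M (\<lambda>_. c)"
  unfolding strongly_measurable_def by (intro exI[of _ "\<lambda>_ _. c"]) auto

lemma strongly_measurable_real:
  fixes r :: "'s \<Rightarrow> real"
  assumes "r \<in> borel_measurable M"
  shows "strongly_measurable M r"
  using borel_measurable_implies_sequence_metric[OF assms, of 0]
  unfolding strongly_measurable_def by blast

lemma strongly_measurable_lincomb: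
  fixes f g :: "'s \<Rightarrow> 'b::banach"
  assumes "strongly_measurable M f" "strongly_measurable M g"
  shows "strongly_measurable M (\<lambda>x. f x - c *\<^sub>R g x)"
proof -
  have "continuous_on UNIV (\<lambda>p :: 'b \<times> 'b. fst p - c *\<^sub>R snd p)"
    by (intro continuous_intros)
  then have "continuous_on UNIV (\<lambda>(a, b). a - c *\<^sub>R b :: 'b)"
    by (simp add: case_prod_unfold)
  from strongly_measurable_compose2[OF assms this] show ?thesis .
qed

lemma strongly_measurable_scaleR:
  fixes r :: "'s \<Rightarrow> real" and f :: "'s \<Rightarrow> 'b::banach"
  assumes "r \<in> borel_measurable M" "strongly_measurable M f"
  shows "strongly_measurable M (\<lambda>x. r x *\<^sub>R f x)"
proof -
  have "continuous_on UNIV (\<lambda>p :: real \<times> 'b. fst p *\<^sub>R snd p)"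
    by (intro continuous_intros)
  then have "continuous_on UNIV (\<lambda>(a, b). a *\<^sub>R b :: 'b)"
    by (simp add: case_prod_unfold)
  from strongly_measurable_compose2[OF strongly_measurable_real[OF assms(1)] assms(2) this]
  show ?thesis .
qed

lemma borel_measurable_norm_strongly:
  assumes "strongly_measurable M f"
  shows "(\<lambda>x. norm (f x)) \<in> borel_measurable M"
proof -
  obtain s where s: "\<And>i::nat. simple_function M (s i)"
      "\<And>x. x \<in> space M \<Longrightarrow> (\<lambda>i. s i x) \<longlonglongrightarrow> f x"
    using assms unfolding strongly_measurable_def by metis
  show ?thesis
  proof (rule borel_measurable_LIMSEQ_real)
    show "(\<lambda>i. norm (s i x)) \<longlonglongrightarrow> norm (f x)" if "x \<in> space M" for x
      by (intro tendsto_norm s that)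
    show "(\<lambda>x. norm (s i x)) \<in> borel_measurable M" for i
      using simple_function_compose1[OF s(1)[of i], of norm]
      by (rule borel_measurable_simple_function)
  qed
qed

lemma strongly_measurable_simple: "simple_function M f \<Longrightarrow> strongly_measurable M f"
  unfolding strongly_measurable_def by (intro exI[of _ "\<lambda>_. f"]) auto

lemma simple_bochner_integrable_strongly:
  "simple_integrable M f \<Longrightarrow> strongly_measurable M f"
  by (auto simp: Bochner_Integration.simple_bochner_integrable.simps intro: strongly_measurable_simple)

lemma borel_measurable_norm_diff_strongly:
  assumes "strongly_measurable M f" "strongly_measurable M g"
  shows "(\<lambda>x. norm (f x - g x)) \<in> borel_measurable M"
  using borel_measurable_norm_strongly[OF strongly_measurable_lincomb[OF assms, of 1]] by simp

lemma norm_simple_bochner_integral_le: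
  assumes "simple_integrable M s"
  shows "ennreal (norm (simple_integral M s)) \<le> (\<integral>\<^sup>+x. ennreal (norm (s x)) \<partial>M)"
proof -
  have "simple_integrable M (\<lambda>x. norm (s x))"
    using simple_bochner_integrable_compose2[of "\<lambda>a b. norm a", OF _ assms assms] by simp
  then have "ennreal (simple_integral M (\<lambda>x. norm (s x)))
      = (\<integral>\<^sup>+x. ennreal (norm (s x)) \<partial>M)"
    by (intro simple_bochner_integral_eq_nn_integral) auto
  then show ?thesis
    using simple_bochner_integral_norm_bound[OF assms] by (metis ennreal_leI)
qed

lemma has_bochner_int_lincomb:
  assumes "has_bochner_int M f y" "has_bochner_int M g z"
  shows "has_bochner_int M (\<lambda>x. f x - c *\<^sub>R g x) (y - c *\<^sub>R z)"
proof -
  obtain s where s: "\<And>i::nat. simple_integrable M (s i)"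
      "(\<lambda>i. \<integral>\<^sup>+x. ennreal (norm (f x - s i x)) \<partial>M) \<longlonglongrightarrow> 0"
      "(\<lambda>i. simple_integral M (s i)) \<longlonglongrightarrow> y"
    and f: "strongly_measurable M f"
    using assms(1) unfolding has_bochner_int_def by blast
  obtain t where t: "\<And>i::nat. simple_integrable M (t i)"
      "(\<lambda>i. \<integral>\<^sup>+x. ennreal (norm (g x - t i x)) \<partial>M) \<longlonglongrightarrow> 0"
      "(\<lambda>i. simple_integral M (t i)) \<longlonglongrightarrow> z"
    and g: "strongly_measurable M g"
    using assms(2) unfolding has_bochner_int_def by blast
  have ct: "simple_integrable M (\<lambda>x. c *\<^sub>R t i x)" for i
    using simple_bochner_integrable_compose2[of "\<lambda>a b. c *\<^sub>R a", OF _ t(1)[of i] t(1)[of i]] by simp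
  have st: "simple_integrable M (\<lambda>x. s i x - c *\<^sub>R t i x)" for i
    using simple_bochner_integrable_compose2[of "\<lambda>a b. a - b", OF _ s(1)[of i] ct[of i]] by simp
  have eq: "simple_integral M (\<lambda>x. s i x - c *\<^sub>R t i x) =
    simple_integral M (s i)
      - c *\<^sub>R simple_integral M (t i)" for i
    using simple_bochner_integral_diff[OF s(1)[of i] ct[of i]]
      simple_bochner_integral_linear[OF linear_scale_self t(1)[of i], of c] by simp
  have le: "(\<integral>\<^sup>+x. ennreal (norm (f x - c *\<^sub>R g x - (s i x - c *\<^sub>R t i x))) \<partial>M)
     \<le> (\<integral>\<^sup>+x. ennreal (norm (f x - s i x)) \<partial>M) + ennreal \<bar>c\<bar> * (\<integral>\<^sup>+x. ennreal (norm (g x - t i x)) \<partial>M)" for i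
  proof -
    have m: "(\<lambda>x. norm (f x - s i x)) \<in> borel_measurable M" "(\<lambda>x. norm (g x - t i x)) \<in> borel_measurable M"
      by (intro borel_measurable_norm_diff_strongly f g simple_bochner_integrable_strongly s t)+
    note [measurable] = m
    have "norm (f x - c *\<^sub>R g x - (s i x - c *\<^sub>R t i x)) \<le> norm (f x - s i x) + \<bar>c\<bar> * norm (g x - t i x)" for x
    proof -
      have "f x - c *\<^sub>R g x - (s i x - c *\<^sub>R t i x) = (f x - s i x) - c *\<^sub>R (g x - t i x)"
        by (simp add: algebra_simps)
      then show ?thesis
        using norm_triangle_ineq4[of "f x - s i x" "c *\<^sub>R (g x - t i x)"] by (metis norm_scaleR)
    qed
    then have "(\<integral>\<^sup>+x. ennreal (norm (f x - c *\<^sub>R g x - (s i x - c *\<^sub>R t i x))) \<partial>M)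
      \<le> (\<integral>\<^sup>+x. ennreal (norm (f x - s i x)) + ennreal \<bar>c\<bar> * ennreal (norm (g x - t i x)) \<partial>M)"
      by (intro nn_integral_mono) (simp flip: ennreal_plus ennreal_mult' add: ennreal_leI)
    also have "\<dots> = (\<integral>\<^sup>+x. ennreal (norm (f x - s i x)) \<partial>M)
        + ennreal \<bar>c\<bar> * (\<integral>\<^sup>+x. ennreal (norm (g x - t i x)) \<partial>M)"
      by (simp add: nn_integral_add nn_integral_cmult)
    finally show ?thesis .
  qed
  have lim: "(\<lambda>i. (\<integral>\<^sup>+x. ennreal (norm (f x - s i x)) \<partial>M)
      + ennreal \<bar>c\<bar> * (\<integral>\<^sup>+x. ennreal (norm (g x - t i x)) \<partial>M)) \<longlonglongrightarrow> 0 + ennreal \<bar>c\<bar> * 0"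
    by (intro tendsto_add ennreal_tendsto_cmult s t) auto
  have "(\<lambda>i. \<integral>\<^sup>+x. ennreal (norm (f x - c *\<^sub>R g x - (s i x - c *\<^sub>R t i x))) \<partial>M) \<longlonglongrightarrow> 0"
    by (rule tendsto_sandwich[OF _ _ tendsto_const lim[simplified]]) (auto intro!: always_eventually le)
  moreover have "(\<lambda>i. simple_integral M (\<lambda>x. s i x - c *\<^sub>R t i x)) \<longlonglongrightarrow> y - c *\<^sub>R z"
    unfolding eq by (intro tendsto_intros s t)
  ultimately show ?thesis
    unfolding has_bochner_int_def
    using strongly_measurable_lincomb[OF f g, of c] st
    by (intro conjI exI[of _ "\<lambda>i x. s i x - c *\<^sub>R t i x"]) auto
qed

lemma norm_has_bochner_int_le:
  assumes "has_bochner_int M f y"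
  shows "ennreal (norm y) \<le> (\<integral>\<^sup>+x. ennreal (norm (f x)) \<partial>M)"
proof -
  obtain s where s: "\<And>i::nat. simple_integrable M (s i)"
      "(\<lambda>i. \<integral>\<^sup>+x. ennreal (norm (f x - s i x)) \<partial>M) \<longlonglongrightarrow> 0"
      "(\<lambda>i. simple_integral M (s i)) \<longlonglongrightarrow> y"
    and f: "strongly_measurable M f"
    using assms unfolding has_bochner_int_def by blast
  have "ennreal (norm (simple_integral M (s i)))
     \<le> (\<integral>\<^sup>+x. ennreal (norm (f x)) \<partial>M) + (\<integral>\<^sup>+x. ennreal (norm (f x - s i x)) \<partial>M)" for i
  proof -
    note [measurable] = borel_measurable_norm_diff_strongly[OF f simple_bochner_integrable_strongly[OF s(1)]]
      borel_measurable_norm_strongly[OF f]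
    have tri: "norm (s i x) \<le> norm (f x) + norm (f x - s i x)" for x
      using norm_triangle_ineq4[of "f x" "f x - s i x"] by simp
    have "ennreal (norm (simple_integral M (s i))) \<le> (\<integral>\<^sup>+x. ennreal (norm (s i x)) \<partial>M)"
      by (rule norm_simple_bochner_integral_le[OF s(1)])
    also have "\<dots> \<le> (\<integral>\<^sup>+x. ennreal (norm (f x)) + ennreal (norm (f x - s i x)) \<partial>M)"
      by (intro nn_integral_mono) (simp flip: ennreal_plus add: ennreal_leI tri)
    finally show ?thesis by (simp add: nn_integral_add)
  qed
  moreover have "(\<lambda>i. (\<integral>\<^sup>+x. ennreal (norm (f x)) \<partial>M) + (\<integral>\<^sup>+x. ennreal (norm (f x - s i x)) \<partial>M))
      \<longlonglongrightarrow> (\<integral>\<^sup>+x. ennreal (norm (f x)) \<partial>M) + 0"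
    by (intro tendsto_add tendsto_const s)
  moreover have "(\<lambda>i. ennreal (norm (simple_integral M (s i)))) \<longlonglongrightarrow> ennreal (norm y)"
    by (intro tendsto_ennrealI tendsto_norm s)
  ultimately show ?thesis
    by (auto intro: LIMSEQ_le)
qed

lemma bochner_int_eqI:
  assumes "has_bochner_int M f y"
  shows "bochner_int M f = y"
proof -
  have *: "z = y" if "has_bochner_int M f z" for z
    using norm_has_bochner_int_le[OF has_bochner_int_lincomb[OF assms that, of 1]] by simp
  have "(THE z. has_bochner_int M f z) = y"
    using assms by (rule the_equality) (rule *)
  moreover have "\<exists>z. has_bochner_int M f z"
    using assms by blast
  ultimately show ?thesis
    unfolding bochner_int_def by simp
qed

text \<open>
  Where the integral does not exist, \<open>bochner_int\<close> takes the default value \<open>0\<close>, so the bound holds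
  for every function.
\<close>

lemma norm_bochner_int_le:
  assumes "(\<integral>\<^sup>+x. ennreal (norm (f x)) \<partial>M) \<le> ennreal C" "0 \<le> C"
  shows "norm (bochner_int M f) \<le> C"
proof (cases "\<exists>y. has_bochner_int M f y")
  case True
  then obtain y where y: "has_bochner_int M f y" by blast
  have "ennreal (norm y) \<le> ennreal C"
    using norm_has_bochner_int_le[OF y] assms(1) by (rule order_trans)
  then show ?thesis
    using assms(2) by (simp add: bochner_int_eqI[OF y])
qed (auto simp: bochner_int_def assms(2))

text \<open>
  The approximating simple functions are cut off where they exceed \<open>2 \<parallel>f\<parallel>\<close>. This keeps the
  pointwise limit and provides an integrable majorant, so dominated convergence for the scalar
  functions \<open>\<parallel>f - t i\<parallel>\<close> applies; completeness of the space then gives the limit of the integrals.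
\<close>

lemma has_bochner_int_bochner_int:
  assumes f: "strongly_measurable M f" and fin: "(\<integral>\<^sup>+x. ennreal (norm (f x)) \<partial>M) < \<infinity>"
  shows "has_bochner_int M f (bochner_int M f)"
proof -
  obtain s where s: "\<And>i::nat. simple_function M (s i)"
      "\<And>x. x \<in> space M \<Longrightarrow> (\<lambda>i. s i x) \<longlonglongrightarrow> f x"
    using f unfolding strongly_measurable_def by metis
  \<comment> \<open>the factor \<open>2\<close> makes the cutoff inactive in the limit at points where \<open>f x \<noteq> 0\<close>\<close>
  define t where "t i x = (if norm (s i x) \<le> 2 * norm (f x) then s i x else 0)" for i x
  note nf[measurable] = borel_measurable_norm_strongly[OF f]
  have t: "simple_function M (t i)" for i
  proof -
    have [measurable]: "(\<lambda>x. norm (s i x)) \<in> borel_measurable M"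
      using simple_function_compose1[OF s(1)[of i], of norm] by (rule borel_measurable_simple_function)
    show ?thesis
      unfolding t_def by (intro simple_function_If s) (auto simp: simple_function_def)
  qed
  have tle: "norm (t i x) \<le> 2 * norm (f x)" for i x
    by (auto simp: t_def)
  have tlim: "(\<lambda>i. t i x) \<longlonglongrightarrow> f x" if "x \<in> space M" for x
  proof (cases "f x = 0")
    case True
    then have "t i x = 0" for i by (auto simp: t_def)
    then show ?thesis using True by simp
  next
    case False
    have "\<forall>\<^sub>F i in sequentially. norm (s i x) < 2 * norm (f x)"
      by (rule order_tendstoD[OF tendsto_norm[OF s(2)[OF that]]]) (use False in simp)
    then have "\<forall>\<^sub>F i in sequentially. t i x = s i x"
      by eventually_elim (auto simp: t_def)
    then show ?thesis
      using s(2)[OF that] by (simp add: tendsto_cong)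
  qed
  have sbi: "simple_integrable M (t i)" for i
  proof (rule simple_bochner_integrableI_bounded[OF t])
    have "(\<integral>\<^sup>+x. ennreal (norm (t i x)) \<partial>M) \<le> (\<integral>\<^sup>+x. 2 * ennreal (norm (f x)) \<partial>M)"
    proof (intro nn_integral_mono)
      fix x
      show "ennreal (norm (t i x)) \<le> 2 * ennreal (norm (f x))"
        using ennreal_leI[OF tle[of i x]] by (simp add: ennreal_mult)
    qed
    also have "\<dots> < \<infinity>"
      using fin by (simp add: nn_integral_cmult ennreal_mult_less_top)
    finally show "(\<integral>\<^sup>+x. ennreal (norm (t i x)) \<partial>M) < \<infinity>" .
  qed
  have m[measurable]: "(\<lambda>x. norm (f x - t i x)) \<in> borel_measurable M" for i
    by (intro borel_measurable_norm_diff_strongly f strongly_measurable_simple t)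
  have conv: "(\<lambda>i. \<integral>\<^sup>+x. ennreal (norm (f x - t i x)) \<partial>M) \<longlonglongrightarrow> 0"
  proof -
    have "(\<lambda>i. \<integral>\<^sup>+x. ennreal (norm (f x - t i x)) \<partial>M) \<longlonglongrightarrow> (\<integral>\<^sup>+x. 0 \<partial>M)"
    proof (rule nn_integral_dominated_convergence[where w = "\<lambda>x. 3 * ennreal (norm (f x))"])
      show "AE x in M. ennreal (norm (f x - t j x)) \<le> 3 * ennreal (norm (f x))" for j
      proof (intro always_eventually allI)
        fix x
        have "norm (f x - t j x) \<le> 3 * norm (f x)"
          using norm_triangle_ineq4[of "f x" "t j x"] tle[of j x] by simp
        then show "ennreal (norm (f x - t j x)) \<le> 3 * ennreal (norm (f x))"
          using ennreal_leI by (fastforce simp: ennreal_mult)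
      qed
      show "(\<integral>\<^sup>+x. 3 * ennreal (norm (f x)) \<partial>M) < \<infinity>"
        using fin by (simp add: nn_integral_cmult ennreal_mult_less_top)
      show "AE x in M. (\<lambda>i. ennreal (norm (f x - t i x))) \<longlonglongrightarrow> 0"
      proof (rule AE_I2)
        fix x assume "x \<in> space M"
        then have "(\<lambda>i. norm (f x - t i x)) \<longlonglongrightarrow> norm (f x - f x)"
          by (intro tendsto_intros tlim)
        then show "(\<lambda>i. ennreal (norm (f x - t i x))) \<longlonglongrightarrow> 0"
          using tendsto_ennrealI by fastforce
      qed
    qed auto
    then show ?thesis by simp
  qed
  have diff: "ennreal (norm (simple_integral M (t i)
      - simple_integral M (t j)))
    \<le> (\<integral>\<^sup>+x. ennreal (norm (f x - t i x)) \<partial>M) + (\<integral>\<^sup>+x. ennreal (norm (f x - t j x)) \<partial>M)" for i j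
  proof -
    have d: "simple_integrable M (\<lambda>x. t i x - t j x)"
      using simple_bochner_integrable_compose2[of "\<lambda>a b. a - b", OF _ sbi[of i] sbi[of j]] by simp
    have "ennreal (norm (simple_integral M (t i)
      - simple_integral M (t j))) \<le> (\<integral>\<^sup>+x. ennreal (norm (t i x - t j x)) \<partial>M)"
      using norm_simple_bochner_integral_le[OF d] by (simp add: simple_bochner_integral_diff sbi)
    also have "\<dots> \<le> (\<integral>\<^sup>+x. ennreal (norm (f x - t i x)) + ennreal (norm (f x - t j x)) \<partial>M)"
    proof (intro nn_integral_mono)
      fix x
      have "norm (t i x - t j x) \<le> norm (f x - t i x) + norm (f x - t j x)"
        using norm_triangle_ineq4[of "f x - t j x" "f x - t i x"] by simp
      then show "ennreal (norm (t i x - t j x)) \<le> ennreal (norm (f x - t i x)) + ennreal (norm (f x - t j x))"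
        by (simp flip: ennreal_plus add: ennreal_leI)
    qed
    finally show ?thesis by (simp add: nn_integral_add)
  qed
  have "Cauchy (\<lambda>i. simple_integral M (t i))"
  proof (rule CauchyI)
    fix e :: real assume "0 < e"
    then have "\<forall>\<^sub>F i in sequentially. (\<integral>\<^sup>+x. ennreal (norm (f x - t i x)) \<partial>M) < ennreal (e / 2)"
      by (intro order_tendstoD[OF conv]) auto
    then obtain n where n: "\<And>i. i \<ge> n \<Longrightarrow> (\<integral>\<^sup>+x. ennreal (norm (f x - t i x)) \<partial>M) < ennreal (e / 2)"
      unfolding eventually_sequentially by blast
    show "\<exists>n. \<forall>i\<ge>n. \<forall>j\<ge>n. norm (simple_integral M (t i)
      - simple_integral M (t j)) < e"
    proof (intro exI allI impI)
      fix i j assume "n \<le> i" "n \<le> j"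
      then have "ennreal (norm (simple_integral M (t i)
          - simple_integral M (t j))) < ennreal (e / 2) + ennreal (e / 2)"
        by (intro le_less_trans[OF diff] add_strict_mono n)
      then show "norm (simple_integral M (t i)
          - simple_integral M (t j)) < e"
        using \<open>0 < e\<close> by (simp flip: ennreal_plus add: ennreal_less_iff)
    qed
  qed
  then obtain y where "(\<lambda>i. simple_integral M (t i)) \<longlonglongrightarrow> y"
    unfolding convergent_eq_Cauchy[symmetric] by blast
  then have "has_bochner_int M f y"
    unfolding has_bochner_int_def using f sbi conv by blast
  then show ?thesis
    by (simp add: bochner_int_eqI)
qed

lemma bochner_int_lincomb:
  assumes "strongly_measurable M f" "(\<integral>\<^sup>+x. ennreal (norm (f x)) \<partial>M) < \<infinity>"
    and "strongly_measurable M g" "(\<integral>\<^sup>+x. ennreal (norm (g x)) \<partial>M) < \<infinity>"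
  shows "bochner_int M (\<lambda>x. f x - c *\<^sub>R g x) = bochner_int M f - c *\<^sub>R bochner_int M g"
  by (intro bochner_int_eqI has_bochner_int_lincomb has_bochner_int_bochner_int assms)

lemma bochner_int_scaleR_const:
  fixes r :: "'s \<Rightarrow> real" and y :: "'a::banach"
  assumes "integrable M r"
  shows "bochner_int M (\<lambda>x. r x *\<^sub>R y) = (\<integral>x. r x \<partial>M) *\<^sub>R y"
proof (rule bochner_int_eqI)
  have r: "has_bochner_integral M r (\<integral>x. r x \<partial>M)" by (rule has_bochner_integral_integrable[OF assms])
  then obtain s where s: "\<And>i::nat. simple_integrable M (s i)"
      "(\<lambda>i. \<integral>\<^sup>+x. ennreal (norm (r x - s i x)) \<partial>M) \<longlonglongrightarrow> 0"
      "(\<lambda>i. simple_integral M (s i)) \<longlonglongrightarrow> (\<integral>x. r x \<partial>M)"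
    and rm: "r \<in> borel_measurable M"
    by (elim has_bochner_integral.cases) blast
  have sb: "simple_integrable M (\<lambda>x. s i x *\<^sub>R y)" for i
    using simple_bochner_integrable_compose2[of "\<lambda>a b. a *\<^sub>R y", OF _ s(1)[of i] s(1)[of i]] by simp
  have eq: "simple_integral M (\<lambda>x. s i x *\<^sub>R y)
      = simple_integral M (s i) *\<^sub>R y" for i
    by (rule simple_bochner_integral_linear[OF _ s(1)])
      (rule bounded_linear.linear[OF bounded_linear_scaleR_left])
  have "(\<integral>\<^sup>+x. ennreal (norm (r x *\<^sub>R y - s i x *\<^sub>R y)) \<partial>M)
      = ennreal (norm y) * (\<integral>\<^sup>+x. ennreal (norm (r x - s i x)) \<partial>M)" for i
  proof -
    have *: "(\<lambda>x. norm (r x - s i x)) \<in> borel_measurable M"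
      by (intro borel_measurable_norm_diff_strongly strongly_measurable_real rm simple_bochner_integrable_strongly s)
    have "(\<integral>\<^sup>+x. ennreal (norm (r x *\<^sub>R y - s i x *\<^sub>R y)) \<partial>M)
        = (\<integral>\<^sup>+x. ennreal (norm y) * ennreal (norm (r x - s i x)) \<partial>M)"
      by (intro nn_integral_cong) (simp flip: scaleR_diff_left ennreal_mult' add: mult.commute)
    then show ?thesis using * by (simp add: nn_integral_cmult)
  qed
  moreover have "(\<lambda>i. ennreal (norm y) * (\<integral>\<^sup>+x. ennreal (norm (r x - s i x)) \<partial>M)) \<longlonglongrightarrow> ennreal (norm y) * 0"
    by (intro ennreal_tendsto_cmult s) auto
  ultimately have "(\<lambda>i. \<integral>\<^sup>+x. ennreal (norm (r x *\<^sub>R y - s i x *\<^sub>R y)) \<partial>M) \<longlonglongrightarrow> 0"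
    by simp
  moreover have "(\<lambda>i. simple_integral M (\<lambda>x. s i x *\<^sub>R y)) \<longlonglongrightarrow> (\<integral>x. r x \<partial>M) *\<^sub>R y"
    unfolding eq by (intro tendsto_intros s)
  ultimately show "has_bochner_int M (\<lambda>x. r x *\<^sub>R y) ((\<integral>x. r x \<partial>M) *\<^sub>R y)"
    unfolding has_bochner_int_def
    using strongly_measurable_scaleR[OF rm strongly_measurable_const] sb
    by (intro conjI exI[of _ "\<lambda>i x. s i x *\<^sub>R y"]) auto
qed

section \<open>Smooth functions and test functions\<close>

definition smooth :: "(real \<Rightarrow> real) \<Rightarrow> bool" where
  "smooth f \<longleftrightarrow> (\<forall>n x. (deriv ^^ n) f field_differentiable (at x))"

text \<open>
  Smoothness by coinduction: a class of differentiable functions that is closed under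
  differentiation consists of smooth functions. This avoids formulas for higher derivatives.
\<close>

lemma smooth_coinduct:
  assumes "Q f"
    and step: "\<And>g. Q g \<Longrightarrow> \<exists>g'. Q g' \<and> (\<forall>x. (g has_field_derivative g' x) (at x))"
  shows "smooth f"
proof -
  have der: "Q (deriv g) \<and> (\<forall>x. g field_differentiable (at x))" if Qg: "Q g" for g
  proof -
    obtain g' where g': "Q g'" "\<And>x. (g has_field_derivative g' x) (at x)"
      using step[OF Qg] by blast
    then have "deriv g = g'"
      by (intro ext DERIV_imp_deriv)
    then show ?thesis
      using g' by (auto simp: field_differentiable_def)
  qed
  have "Q ((deriv ^^ n) f)" for n
    by (induction n) (use assms(1) der in auto)
  then show ?thesis
    unfolding smooth_def using der by blast
qed

lemma smooth_deriv:
  assumes "smooth f"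
  shows "smooth (deriv f)" "(f has_field_derivative deriv f x) (at x)"
proof -
  have "(deriv ^^ n) (deriv f) field_differentiable (at x)" for n x
    using assms unfolding smooth_def by (metis comp_apply funpow_Suc_right)
  then show "smooth (deriv f)"
    unfolding smooth_def by blast
  have "(deriv ^^ 0) f field_differentiable (at x)"
    using assms unfolding smooth_def by blast
  then show "(f has_field_derivative deriv f x) (at x)"
    by (simp add: DERIV_deriv_iff_field_differentiable)
qed

lemma smooth_lincomb:
  assumes "smooth f" "smooth g"
  shows "smooth (\<lambda>x. f x - c * g x)"
proof (rule smooth_coinduct[where Q = "\<lambda>h. \<exists>f g. smooth f \<and> smooth g \<and> h = (\<lambda>x. f x - c * g x)"])
  show "\<exists>f' g'. smooth f' \<and> smooth g' \<and> (\<lambda>x. f x - c * g x) = (\<lambda>x. f' x - c * g' x)"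
    using assms by blast
next
  fix h assume "\<exists>f g. smooth f \<and> smooth g \<and> h = (\<lambda>x. f x - c * g x)"
  then obtain f g where fg: "smooth f" "smooth g" "h = (\<lambda>x. f x - c * g x)"
    by blast
  have "(h has_field_derivative deriv f x - c * deriv g x) (at x)" for x
    unfolding fg(3) by (intro DERIV_diff DERIV_cmult smooth_deriv fg)
  then show "\<exists>h'. (\<exists>f g. smooth f \<and> smooth g \<and> h' = (\<lambda>x. f x - c * g x)) \<and>
      (\<forall>x. (h has_field_derivative h' x) (at x))"
    using smooth_deriv(1)[OF fg(1)] smooth_deriv(1)[OF fg(2)]
    by (intro exI[of _ "\<lambda>x. deriv f x - c * deriv g x"]) blast
qed

lemma smooth_antideriv:
  assumes "smooth g" "\<And>x. (f has_field_derivative g x) (at x)"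
  shows "smooth f"
proof (rule smooth_coinduct[where Q = "\<lambda>h. h = f \<or> smooth h"])
  fix h assume "h = f \<or> smooth h"
  then show "\<exists>h'. (h' = f \<or> smooth h') \<and> (\<forall>x. (h has_field_derivative h' x) (at x))"
    using assms smooth_deriv by blast
qed simp

text \<open>
  With \<open>q = (x - a) (b - x)\<close>, the functions \<open>P/q^n exp(-1/q)\<close> on \<open>(a, b)\<close>, extended by zero, form
  a class that is closed under differentiation; \<open>n = 0\<close> and \<open>P = 1\<close> give the usual bump function.
\<close>

definition bump :: "real \<Rightarrow> real \<Rightarrow> nat \<Rightarrow> real poly \<Rightarrow> real \<Rightarrow> real" where
  "bump a b n P x = (if a < x \<and> x < b
    then poly P x / ((x - a) * (b - x)) ^ n * exp (- 1 / ((x - a) * (b - x))) else 0)"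

text \<open>
  The exponential series yields \<open>y^(n+2) \<le> (n+2)! exp y\<close>; for \<open>y = 1/q\<close> the factor \<open>exp(-1/q)\<close>
  absorbs the pole \<open>q^-n\<close> and leaves a square, which is what differentiability at the end points
  of the interval requires.
\<close>

lemma bump_le:
  assumes "a < b"
  obtains C where "\<And>x. \<bar>bump a b n P x\<bar> \<le> (if a < x \<and> x < b then C * ((x - a) * (b - x))\<^sup>2 else 0)"
proof -
  have "bounded (poly P ` {a..b})"
    by (intro compact_imp_bounded compact_continuous_image continuous_intros compact_Icc)
  then obtain K where K: "\<And>x. x \<in> {a..b} \<Longrightarrow> \<bar>poly P x\<bar> \<le> K"
    unfolding bounded_iff by fastforce
  have "\<bar>bump a b n P x\<bar> \<le> K * fact (n + 2) * ((x - a) * (b - x))\<^sup>2" if x: "a < x" "x < b" for x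
  proof -
    define q where "q = (x - a) * (b - x)"
    have q: "0 < q" using x by (simp add: q_def)
    have "(\<Sum>i\<in>{n + 2}. (1 / q) ^ i /\<^sub>R fact i) \<le> exp (1 / q)"
      unfolding exp_def using q
      by (intro sum_le_suminf summable_exp_generic) auto
    then have "(1 / q) ^ (n + 2) / fact (n + 2) \<le> exp (1 / q)"
      by (simp only: sum.insert sum.empty finite.emptyI empty_iff divide_inverse_commute
        real_scaleR_def add_0_right not_False_eq_True)
    then have "(1 / q) ^ (n + 2) \<le> fact (n + 2) * exp (1 / q)"
      by (simp only: pos_divide_le_eq[OF fact_gt_zero] mult.commute)
    then have "1 \<le> fact (n + 2) * exp (1 / q) * q ^ (n + 2)"
      using q by (simp add: field_simps del: fact_Suc power_Suc)
    then have "exp (- (1 / q)) \<le> fact (n + 2) * q ^ (n + 2)"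
      by (simp add: exp_minus field_simps del: fact_Suc power_Suc)
    then have "exp (- 1 / q) / q ^ n \<le> fact (n + 2) * q\<^sup>2"
      using q by (simp add: field_simps power_add power2_eq_square del: fact_Suc)
    then have "\<bar>poly P x\<bar> * (exp (- 1 / q) / q ^ n) \<le> K * (fact (n + 2) * q\<^sup>2)"
      using K[of x] x q by (intro mult_mono) auto
    then show ?thesis
      using x q by (simp add: bump_def q_def[symmetric] abs_mult mult.assoc del: fact_Suc)
  qed
  then show ?thesis
    by (intro that[of "K * fact (n + 2)"]) (auto simp: bump_def)
qed

text \<open>
  Inside \<open>(a, b)\<close> this is the quotient rule. At a point \<open>x\<close> outside, including the end points,
  \<open>q(y) \<le> (b - a) \<bar>y - x\<bar>\<close> on \<open>(a, b)\<close>, so the quadratic bound makes the difference quotient tend to \<open>0\<close>.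
\<close>

lemma DERIV_bump:
  assumes "a < b"
  defines "q \<equiv> [:-a, 1:] * [:b, -1:]"
  shows "(bump a b n P has_field_derivative
    bump a b (n + 2) (pderiv P * q\<^sup>2 - of_nat n * P * pderiv q * q + P * pderiv q) x) (at x)"
proof (cases "a < x \<and> x < b")
  case True
  have pq: "poly q y = (y - a) * (b - y)" for y
    by (simp add: q_def algebra_simps)
  have q: "poly q x \<noteq> 0" using True by (simp add: pq)
  have "((\<lambda>x. poly P x / poly q x ^ n * exp (- 1 / poly q x)) has_field_derivative
    poly (pderiv P * q\<^sup>2 - of_nat n * P * pderiv q * q + P * pderiv q) x
      / poly q x ^ (n + 2) * exp (- 1 / poly q x)) (at x)"
  proof -
    have pow: "((\<lambda>x. poly q x ^ n) has_field_derivative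
        of_nat n * poly (pderiv q) x * poly q x ^ n / poly q x) (at x)"
      by (rule DERIV_cong[OF DERIV_power[OF poly_DERIV]]) (use q in \<open>cases n; simp\<close>)
    have exp: "((\<lambda>x. exp (- 1 / poly q x)) has_field_derivative
        exp (- 1 / poly q x) * (poly (pderiv q) x / (poly q x)\<^sup>2)) (at x)"
      using q by (auto intro!: derivative_eq_intros poly_DERIV simp: power2_eq_square)
    have "poly q x ^ n \<noteq> 0"
      using q by simp
    from DERIV_mult[OF DERIV_divide[OF poly_DERIV[of P x] pow this] exp]
    show ?thesis
      by (rule DERIV_cong) (use q in \<open>simp add: power_add power2_eq_square, simp add: field_simps\<close>)
  qed
  then show ?thesis
    unfolding bump_def pq using True
    by (auto intro: has_field_derivative_transform_within_open[of _ _ _ "{a<..<b}"])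
next
  case False
  obtain C where C: "\<And>x. \<bar>bump a b n P x\<bar> \<le> (if a < x \<and> x < b then C * ((x - a) * (b - x))\<^sup>2 else 0)"
    using bump_le[OF assms(1)] by blast
  have "(bump a b n P has_field_derivative 0) (at x)"
  proof -
    have C0: "0 \<le> C"
    proof -
      have "0 \<le> C * (((a+b)/2 - a) * (b - (a+b)/2))\<^sup>2"
        using C[of "(a+b)/2"] assms(1) by (auto intro: order_trans[OF abs_ge_zero])
      moreover have "0 < (((a+b)/2 - a) * (b - (a+b)/2))\<^sup>2"
        using assms(1) by simp
      ultimately show ?thesis
        by (metis mult_neg_pos not_le)
    qed
    have le: "\<bar>bump a b n P y\<bar> \<le> (C * (b - a)\<^sup>2) * (y - x)\<^sup>2" for y
    proof (cases "a < y \<and> y < b")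
      case True
      have "(y - a) * (b - y) \<le> \<bar>y - x\<bar> * (b - a)"
      proof (cases "x \<le> a")
        case True
        then show ?thesis using \<open>a < y \<and> y < b\<close> by (intro mult_mono) auto
      next
        case False
        then have "(b - y) * (y - a) \<le> \<bar>y - x\<bar> * (b - a)"
          using \<open>a < y \<and> y < b\<close> \<open>\<not> (a < x \<and> x < b)\<close> by (intro mult_mono) auto
        then show ?thesis by (simp add: mult.commute)
      qed
      then have "((y - a) * (b - y))\<^sup>2 \<le> (\<bar>y - x\<bar> * (b - a))\<^sup>2"
        using True by (intro power_mono) auto
      then have "C * ((y - a) * (b - y))\<^sup>2 \<le> C * (\<bar>y - x\<bar> * (b - a))\<^sup>2"
        using C0 by (rule mult_left_mono)
      also have "\<dots> = (C * (b - a)\<^sup>2) * (y - x)\<^sup>2"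
        by (simp add: power_mult_distrib)
      finally show ?thesis
        using C[of y] True by auto
    next
      case False
      then have "bump a b n P y = 0"
        unfolding bump_def by (rule if_not_P)
      then show ?thesis
        using C0 by simp
    qed
    have bx: "bump a b n P x = 0" unfolding bump_def by (rule if_not_P[OF False])
    have "((\<lambda>y. (bump a b n P y - bump a b n P x) / (y - x)) \<longlongrightarrow> 0) (at x)"
    proof (rule Lim_null_comparison)
      show "\<forall>\<^sub>F y in at x. norm ((bump a b n P y - bump a b n P x) / (y - x)) \<le> (C * (b - a)\<^sup>2) * \<bar>y - x\<bar>"
      proof (rule always_eventually, rule allI)
        fix y
        show "norm ((bump a b n P y - bump a b n P x) / (y - x)) \<le> (C * (b - a)\<^sup>2) * \<bar>y - x\<bar>"
        proof (cases "y = x")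
          case False
          have "\<bar>bump a b n P y\<bar> / \<bar>y - x\<bar> \<le> ((C * (b - a)\<^sup>2) * (y - x)\<^sup>2) / \<bar>y - x\<bar>"
            using le[of y] by (intro divide_right_mono) auto
          also have "\<dots> = (C * (b - a)\<^sup>2) * \<bar>y - x\<bar>"
          proof -
            have "(y - x)\<^sup>2 / \<bar>y - x\<bar> = \<bar>y - x\<bar>"
              using False by (simp add: power2_eq_square abs_if field_simps)
            then show ?thesis by (metis times_divide_eq_right)
          qed
          finally show ?thesis by (simp add: bx)
        qed simp
      qed
      have "((\<lambda>y. (C * (b - a)\<^sup>2) * \<bar>y - x\<bar>) \<longlongrightarrow> (C * (b - a)\<^sup>2) * \<bar>x - x\<bar>) (at x)"
        by (intro tendsto_intros)
      then show "((\<lambda>y. (C * (b - a)\<^sup>2) * \<bar>y - x\<bar>) \<longlongrightarrow> 0) (at x)" by simp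
    qed
    then show ?thesis
      by (simp add: has_field_derivative_iff)
  qed
  moreover have "bump a b m R x = 0" for m R
    unfolding bump_def by (rule if_not_P[OF False])
  ultimately show ?thesis
    by simp
qed

lemma smooth_bump:
  assumes "a < b"
  shows "smooth (bump a b n P)"
proof (rule smooth_coinduct[where Q = "\<lambda>h. \<exists>n P. h = bump a b n P"])
  fix h assume "\<exists>n P. h = bump a b n P"
  then show "\<exists>h'. (\<exists>n P. h' = bump a b n P) \<and> (\<forall>x. (h has_field_derivative h' x) (at x))"
    using DERIV_bump[OF assms] by blast
qed blast

lemma smooth_test_apply: "smooth (test_apply \<phi>)"
  using test_apply[of \<phi>] by (simp add: smooth_def)

lemma test_apply_test_deriv: "test_apply (test_deriv \<phi>) = deriv (test_apply \<phi>)"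
  by (rule test_deriv.rep_eq)

lemma DERIV_test_apply:
  "(test_apply \<phi> has_field_derivative test_apply (test_deriv \<phi>) x) (at x)"
  unfolding test_apply_test_deriv by (rule smooth_deriv[OF smooth_test_apply])

lemma continuous_on_test_apply [continuous_intros]: "continuous_on S (test_apply \<phi>)"
  by (meson DERIV_test_apply DERIV_isCont continuous_at_imp_continuous_on)

lemma borel_measurable_test_apply [measurable]:
  "test_apply \<phi> \<in> borel_measurable borel"
  by (intro borel_measurable_continuous_onI continuous_on_test_apply)

lemma test_apply_support:
  obtains a b where "0 < a" "\<And>x. x \<notin> {a..b} \<Longrightarrow> test_apply \<phi> x = 0"
  using test_apply[of \<phi>] by blast

lemma test_apply_nonpos [simp]: "x \<le> 0 \<Longrightarrow> test_apply \<phi> x = 0"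
  by (rule test_apply_support[of \<phi>]) auto

lemma obtain_test_fun:
  assumes "smooth f" "0 < a" "\<And>x. x \<notin> {a..b} \<Longrightarrow> f x = 0"
  obtains \<phi> where "test_apply \<phi> = f"
proof -
  have "f \<in> {\<phi>. (\<forall>n x. (deriv ^^ n) \<phi> field_differentiable at x) \<and> (\<exists>a>0. \<exists>b. \<forall>x. x \<notin> {a..b} \<longrightarrow> \<phi> x = 0)}"
    using assms unfolding smooth_def by blast
  then show ?thesis
    using that Abs_test_fun_inverse by blast
qed

lemma integrable_on_test_apply [simp]: "test_apply \<phi> integrable_on {u..v}"
  by (intro integrable_continuous_interval continuous_intros)

lemma integrable_on_abs_test_apply [simp]: "(\<lambda>x. \<bar>test_apply \<phi> x\<bar>) integrable_on {u..v}"
  by (intro integrable_continuous_interval continuous_intros)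

lemma normalized_test_fun:
  assumes "0 < a" "a < b"
  obtains \<theta> where "\<And>x. 0 \<le> test_apply \<theta> x" "\<And>x. x \<notin> {a..b} \<Longrightarrow> test_apply \<theta> x = 0"
    "integral {a..b} (test_apply \<theta>) = 1"
proof -
  define f where "f = bump a b 0 1"
  have f: "smooth f" "\<And>x. 0 \<le> f x" "\<And>x. x \<notin> {a..b} \<Longrightarrow> f x = 0"
    using smooth_bump[OF assms(2)] by (auto simp: f_def bump_def)
  have cont: "continuous_on {a..b} f"
    by (meson smooth_deriv(2)[OF f(1)] DERIV_isCont continuous_at_imp_continuous_on)
  have int: "f integrable_on {a..b}"
    by (rule integrable_continuous_interval[OF cont])
  define I where "I = integral {a..b} f"
  have "I \<noteq> 0"
  proof
    assume "I = 0"
    then have "(f has_integral 0) (cbox a b)"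
      using integrable_integral[OF int] by (simp add: I_def)
    then have "f ((a + b) / 2) = 0"
      using cont f(2) assms by (intro has_integral_0_cbox_imp_0[of a b f]) auto
    then show False
      using assms by (simp add: f_def bump_def)
  qed
  moreover have "0 \<le> I"
    unfolding I_def by (intro integral_nonneg int f)
  ultimately have I: "0 < I" by simp
  \<comment> \<open>\<open>f / I\<close>, written in the form to which \<open>smooth_lincomb\<close> applies\<close>
  have "smooth (\<lambda>x. f x - (1 - 1 / I) * f x)"
    by (intro smooth_lincomb f)
  moreover have "(\<lambda>x. f x - (1 - 1 / I) * f x) = (\<lambda>x. f x / I)"
    by (auto simp: algebra_simps)
  ultimately have "smooth (\<lambda>x. f x / I)" by simp
  then obtain \<theta> where \<theta>: "test_apply \<theta> = (\<lambda>x. f x / I)"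
    using obtain_test_fun[of "\<lambda>x. f x / I" a b] assms f by auto
  show ?thesis
  proof (rule that[of \<theta>])
    show "integral {a..b} (test_apply \<theta>) = 1"
      using I by (simp add: \<theta> I_def)
  qed (use \<theta> f I in auto)
qed

text \<open>
  Vanishing of the total mass makes the antiderivative vanish to the right of the support again,
  so that it is a test function.
\<close>

lemma test_antideriv:
  assumes int: "integral {0..1} (test_apply \<phi>) = 0" and supp: "\<And>x. 1 < x \<Longrightarrow> test_apply \<phi> x = 0"
  obtains \<Phi> where "test_deriv \<Phi> = \<phi>" "\<And>x. test_apply \<Phi> x = integral {0..x} (test_apply \<phi>)"
    "\<And>x. 1 < x \<Longrightarrow> test_apply \<Phi> x = 0"
proof -
  define F where "F x = integral {0..x} (test_apply \<phi>)" for x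
  obtain a b where a: "0 < a" and ab: "\<And>x. x \<notin> {a..b} \<Longrightarrow> test_apply \<phi> x = 0"
    using test_apply_support by blast
  have F0: "F x = 0" if "x < a" for x
  proof -
    have "integral {0..x} (test_apply \<phi>) = integral {0..x} (\<lambda>_. 0)"
      by (intro integral_cong ab) (use that in auto)
    then show ?thesis by (simp add: F_def)
  qed
  have F1: "F x = 0" if "1 < x" for x
  proof -
    have "F x = integral {0..1} (test_apply \<phi>) + integral {1..x} (test_apply \<phi>)"
      unfolding F_def using that by (intro Henstock_Kurzweil_Integration.integral_combine[symmetric]) auto
    also have "integral {1..x} (test_apply \<phi>) = integral {1..x} (\<lambda>_. 0)"
      by (rule integral_spike[of "{1}"]) (use supp in auto)
    finally show ?thesis by (simp add: int)
  qed
  have der: "(F has_field_derivative test_apply \<phi> x) (at x)" for x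
  proof (cases "x < a")
    case True
    have "((\<lambda>_. 0 :: real) has_field_derivative test_apply \<phi> x) (at x)"
      using ab[of x] True by simp
    then show ?thesis
      by (rule has_field_derivative_transform_within_open[of _ _ _ "{..<a}"]) (use True F0 in auto)
  next
    case False
    have "((\<lambda>u. integral {0..u} (test_apply \<phi>)) has_real_derivative test_apply \<phi> x) (at x within {0..x+1})"
      by (rule integral_has_real_derivative) (use False a in \<open>auto intro: continuous_on_test_apply\<close>)
    moreover have "at x within {0..x+1} = at x"
      using False a by (intro at_within_interior) auto
    ultimately show ?thesis by (simp add: F_def[abs_def])
  qed
  have "smooth F"
    by (rule smooth_antideriv[OF smooth_test_apply[of \<phi>] der])
  then obtain \<Phi> where \<Phi>: "test_apply \<Phi> = F"
    by (rule obtain_test_fun[of F a 1]) (use a F0 F1 in \<open>auto simp: not_le\<close>)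
  have "test_apply (test_deriv \<Phi>) = test_apply \<phi>"
    unfolding test_apply_test_deriv \<Phi> by (intro ext DERIV_imp_deriv der)
  then have "test_deriv \<Phi> = \<phi>"
    by (simp add: test_apply_inject)
  then show ?thesis
    using that \<Phi> F1 F_def by metis
qed

text \<open>
  The constant \<open>c\<close> is the mass of \<open>\<psi>\<close>, so that \<open>\<psi> - c \<theta>\<close> has mass zero and the antiderivative \<open>\<Psi>\<close>
  is again a test function. The bound on \<open>\<Psi>\<close> involves \<open>\<psi>\<close> only through \<open>C\<close>; the contribution of \<open>\<theta>\<close>
  is harmless because \<open>\<theta>\<close> vanishes for \<open>x < 1/2\<close> and \<open>x^j \<ge> 2^-j\<close> for the other \<open>x\<close>.
\<close>

lemma test_fun_decomposition:
  assumes \<theta>: "\<And>x. 0 \<le> test_apply \<theta> x" "\<And>x. x \<notin> {1/2..1} \<Longrightarrow> test_apply \<theta> x = 0"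
      "integral {1/2..1} (test_apply \<theta>) = 1"
    and supp: "\<And>x. 1 < x \<Longrightarrow> test_apply \<psi> x = 0"
    and le: "\<And>x. 0 \<le> x \<Longrightarrow> x \<le> 1 \<Longrightarrow> integral {0..x} (\<lambda>y. \<bar>test_apply \<psi> y\<bar>) \<le> C * x ^ j"
  obtains \<Psi> c where "\<bar>c\<bar> \<le> C"
    "\<And>x. test_apply (test_deriv \<Psi>) x = test_apply \<psi> x - c * test_apply \<theta> x"
    "\<And>x. 1 < x \<Longrightarrow> test_apply \<Psi> x = 0"
    "\<And>x. 0 \<le> x \<Longrightarrow> x \<le> 1 \<Longrightarrow> \<bar>test_apply \<Psi> x\<bar> \<le> C * (1 + 2 ^ j) * x ^ j"
proof -
  define c where "c = integral {0..1} (test_apply \<psi>)"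
  have abs_le: "\<bar>integral {0..x} (test_apply \<psi>)\<bar> \<le> C * x ^ j" if "0 \<le> x" "x \<le> 1" for x
  proof -
    have "\<bar>integral {0..x} (test_apply \<psi>)\<bar> \<le> integral {0..x} (\<lambda>y. \<bar>test_apply \<psi> y\<bar>)"
      using integral_norm_bound_integral[of "test_apply \<psi>" "{0..x}" "\<lambda>y. \<bar>test_apply \<psi> y\<bar>"] by simp
    then show ?thesis using le[OF that] by linarith
  qed
  have c: "\<bar>c\<bar> \<le> C"
    using abs_le[of 1] by (simp add: c_def)
  have \<theta>0: "integral {0..x} (test_apply \<theta>) = 0" if "x \<le> 1/2" for x
  proof -
    have "integral {0..x} (test_apply \<theta>) = integral {0..x} (\<lambda>_. 0)"
      by (rule integral_spike[of "{1/2}"]) (use \<theta>(2) that in auto)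
    then show ?thesis by simp
  qed
  have \<theta>1: "integral {0..1} (test_apply \<theta>) = 1"
    using \<theta>0[of "1/2"] \<theta>(3)
      Henstock_Kurzweil_Integration.integral_combine[of 0 "1/2" 1 "test_apply \<theta>"] by simp
  have \<theta>le: "\<bar>integral {0..x} (test_apply \<theta>)\<bar> \<le> 2 ^ j * x ^ j" if "0 \<le> x" "x \<le> 1" for x
  proof (cases "x \<le> 1/2")
    case True
    then show ?thesis using \<theta>0 that by simp
  next
    case False
    have "0 \<le> integral {0..x} (test_apply \<theta>)"
      by (intro integral_nonneg \<theta>) simp
    moreover have "integral {0..x} (test_apply \<theta>) \<le> integral {0..1} (test_apply \<theta>)"
      using that \<theta>(1) by (intro integral_subset_le) auto
    moreover have "1 \<le> (2 * x) ^ j"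
      using False by (intro one_le_power) auto
    ultimately show ?thesis
      by (simp add: \<theta>1 power_mult_distrib)
  qed
  have "smooth (\<lambda>x. test_apply \<psi> x - c * test_apply \<theta> x)"
    by (intro smooth_lincomb smooth_test_apply)
  moreover obtain a b where ab: "0 < a" "\<And>x. x \<notin> {a..b} \<Longrightarrow> test_apply \<psi> x = 0"
    using test_apply_support by blast
  moreover have "test_apply \<psi> x - c * test_apply \<theta> x = 0" if "x \<notin> {min a (1/2)..1}" for x
    using that ab(2)[of x] \<theta>(2)[of x] supp[of x] by (auto simp: not_le)
  ultimately obtain \<phi> where \<phi>: "test_apply \<phi> = (\<lambda>x. test_apply \<psi> x - c * test_apply \<theta> x)"
    using obtain_test_fun[of "\<lambda>x. test_apply \<psi> x - c * test_apply \<theta> x" "min a (1/2)" 1] ab(1) by auto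
  have int: "integral {0..x} (test_apply \<phi>) = integral {0..x} (test_apply \<psi>) - c * integral {0..x} (test_apply \<theta>)" for x
    unfolding \<phi> by (subst Henstock_Kurzweil_Integration.integral_diff) (auto intro!: integrable_on_mult_right)
  have "integral {0..1} (test_apply \<phi>) = 0"
    by (simp add: int \<theta>1 c_def)
  moreover have "test_apply \<phi> x = 0" if "1 < x" for x
    using supp[OF that] \<theta>(2)[of x] that by (simp add: \<phi>)
  ultimately obtain \<Psi> where \<Psi>: "test_deriv \<Psi> = \<phi>"
      "\<And>x. test_apply \<Psi> x = integral {0..x} (test_apply \<phi>)" "\<And>x. 1 < x \<Longrightarrow> test_apply \<Psi> x = 0"
    using test_antideriv[of \<phi>] by metis
  show ?thesis
  proof (rule that[of c \<Psi>])
    fix x :: real assume x: "0 \<le> x" "x \<le> 1"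
    have "\<bar>test_apply \<Psi> x\<bar> \<le> \<bar>integral {0..x} (test_apply \<psi>)\<bar> + \<bar>c\<bar> * \<bar>integral {0..x} (test_apply \<theta>)\<bar>"
      unfolding \<Psi>(2) int using abs_triangle_ineq4[of "integral {0..x} (test_apply \<psi>)" "c * integral {0..x} (test_apply \<theta>)"]
      by (simp add: abs_mult)
    also have "\<dots> \<le> C * x ^ j + C * (2 ^ j * x ^ j)"
      using c x by (intro add_mono mult_mono abs_le \<theta>le) auto
    finally show "\<bar>test_apply \<Psi> x\<bar> \<le> C * (1 + 2 ^ j) * x ^ j"
      by (simp add: algebra_simps)
  qed (use c \<Psi> \<phi> in auto)
qed

lemma test_fun_dominated:
  assumes \<theta>: "\<And>x. x \<notin> {1/2..1} \<Longrightarrow> test_apply \<theta> x = 0"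
  obtains K where "0 \<le> K" "\<And>x. 0 \<le> x \<Longrightarrow> \<bar>test_apply \<theta> x\<bar> \<le> K * x ^ j"
proof -
  have "bounded (test_apply \<theta> ` {1/2..1})"
    by (intro compact_imp_bounded compact_continuous_image continuous_intros compact_Icc)
  then obtain K where K: "\<And>x. x \<in> {1/2..1} \<Longrightarrow> \<bar>test_apply \<theta> x\<bar> \<le> K"
    unfolding bounded_iff by fastforce
  have K0: "0 \<le> K" using K[of 1] by auto
  have "\<bar>test_apply \<theta> x\<bar> \<le> (K * 2 ^ j) * x ^ j" if "0 \<le> x" for x
  proof (cases "x \<in> {1/2..1}")
    case True
    then have "1 \<le> (2 * x) ^ j" by (intro one_le_power) auto
    then have "K * 1 \<le> K * (2 * x) ^ j" using K0 by (rule mult_left_mono)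
    then show ?thesis using K[OF True] by (simp add: power_mult_distrib)
  next
    case False
    then show ?thesis using \<theta>[OF False] K0 that by simp
  qed
  then show ?thesis
    using that[of "K * 2 ^ j"] K0 by simp
qed

section \<open>Weighted Lebesgue spaces on the half line\<close>

abbreviation half_line :: "real measure" where
  "half_line \<equiv> lebesgue_on {0<..}"

lemma borel_measurable_half_line:
  assumes "f \<in> borel_measurable borel"
  shows "f \<in> borel_measurable half_line"
  by (intro measurable_restrict_space1 measurable_completion) (use assms in simp)

lemma nn_integral_half_line_lborel:
  assumes "f \<in> borel_measurable borel"
  shows "(\<integral>\<^sup>+x. f x \<partial>half_line) = (\<integral>\<^sup>+x. f x * indicator {0<..} x \<partial>lborel)"
  using assms by (simp add: nn_integral_restrict_space nn_integral_completion)

lemma nn_integral_powr_half_line: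
  assumes "-1 < a"
  shows "(\<integral>\<^sup>+x. ennreal (if x \<le> 1 then x powr a else 0) \<partial>half_line) = ennreal (1 / (a + 1))"
proof -
  have "((\<lambda>x. x powr a) has_integral 1 powr (a + 1) / (a + 1)) {0..1}"
    by (rule has_integral_powr_from_0) (use assms in auto)
  then have I: "((\<lambda>x. x powr a) has_integral 1 / (a + 1)) {0..1}"
    by simp
  have "(\<integral>\<^sup>+x. ennreal (if x \<le> 1 then x powr a else 0) \<partial>half_line) =
      (\<integral>\<^sup>+x. ennreal (if x \<le> 1 then x powr a else 0) * indicator {0<..} x \<partial>lborel)"
    by (rule nn_integral_half_line_lborel) simp
  also have "\<dots> = (\<integral>\<^sup>+x. ennreal (indicator {0..1} x * x powr a) \<partial>lborel)"
    by (intro nn_integral_cong) (auto simp: indicator_def)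
  also have "\<dots> = ennreal (1 / (a + 1))"
    by (rule nn_integral_has_integral_lebesgue[OF _ I]) simp
  finally show ?thesis .
qed

lemma nn_integral_exp_powr_half_line:
  assumes "-1 < a"
  shows "(\<integral>\<^sup>+x. ennreal (x powr a * exp (- x)) \<partial>half_line) < \<infinity>"
proof -
  have "(\<integral>\<^sup>+x. ennreal (x powr a * exp (- x)) \<partial>half_line)
      = (\<integral>\<^sup>+x. ennreal (x powr a * exp (- x)) * indicator {0<..} x \<partial>lborel)"
    by (rule nn_integral_half_line_lborel) simp
  also have "\<dots> = (\<integral>\<^sup>+t. ennreal (indicator {0..} t * t powr (a + 1 - 1) / exp t) \<partial>lborel)"
    by (intro nn_integral_cong) (auto simp: indicator_def exp_minus field_simps)
  also have "\<dots> = ennreal (Gamma (a + 1))"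
    by (rule Gamma_conv_nn_integral_real[symmetric]) (use assms in simp)
  finally show ?thesis by simp
qed

lemma integral_half_line_compact_support:
  fixes r :: "real \<Rightarrow> real"
  assumes "continuous_on UNIV r" "\<And>x. x \<le> 0 \<or> B < x \<Longrightarrow> r x = 0"
  shows "integrable half_line r" "(\<integral>x. r x \<partial>half_line) = integral {0..B} r"
proof -
  have eq: "indicator {0<..} x *\<^sub>R r x = indicator {0..B} x *\<^sub>R r x" for x
    using assms(2)[of x] by (auto simp: indicator_def)
  have abs: "set_integrable lebesgue {0..B} r"
    by (rule absolutely_integrable_continuous_real) (use assms(1) continuous_on_subset in blast)
  have "set_integrable lebesgue {0<..} r"
    using abs unfolding set_integrable_def eq .
  then show "integrable half_line r"
    by (simp add: integrable_restrict_space set_integrable_def)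
  have "(\<integral>x. r x \<partial>half_line) = (LINT x:{0<..}|lebesgue. r x)"
    by (simp add: integral_restrict_space set_lebesgue_integral_def)
  also have "\<dots> = (LINT x:{0..B}|lebesgue. r x)"
    unfolding set_lebesgue_integral_def eq ..
  also have "\<dots> = integral {0..B} r"
    by (rule set_lebesgue_integral_eq_integral(2)[OF abs])
  finally show "(\<integral>x. r x \<partial>half_line) = integral {0..B} r" .
qed

lemma strongly_measurable_half_line_measure [simp]:
  "strongly_measurable (half_line_measure \<gamma>) f \<longleftrightarrow> strongly_measurable half_line f"
proof -
  have "simple_function (half_line_measure \<gamma>) s \<longleftrightarrow> simple_function half_line s" for s :: "real \<Rightarrow> 'a"
    by (rule simple_function_cong_algebra) (auto simp: half_line_measure_def)
  then show ?thesis
    by (simp add: strongly_measurable_def half_line_measure_def)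
qed

lemma nn_integral_half_line_measure:
  assumes "u \<in> borel_measurable half_line"
  shows "(\<integral>\<^sup>+x. ennreal (u x) \<partial>half_line_measure \<gamma>) = (\<integral>\<^sup>+x. ennreal (x powr \<gamma> * u x) \<partial>half_line)"
proof -
  have "(\<lambda>x. ennreal (\<bar>x\<bar> powr \<gamma>)) \<in> borel_measurable half_line"
    by (rule borel_measurable_half_line) measurable
  moreover have "(\<lambda>x. ennreal (u x)) \<in> borel_measurable half_line"
    using assms by measurable
  ultimately have "(\<integral>\<^sup>+x. ennreal (u x) \<partial>half_line_measure \<gamma>)
      = (\<integral>\<^sup>+x. ennreal (\<bar>x\<bar> powr \<gamma>) * ennreal (u x) \<partial>half_line)"
    unfolding half_line_measure_def by (rule nn_integral_density)
  also have "\<dots> = (\<integral>\<^sup>+x. ennreal (x powr \<gamma> * u x) \<partial>half_line)"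
    by (intro nn_integral_cong) (simp add: ennreal_mult')
  finally show ?thesis .
qed

lemma borel_measurable_norm_powr:
  assumes "strongly_measurable M f"
  shows "(\<lambda>x. norm (f x) powr p) \<in> borel_measurable M"
  using borel_measurable_norm_strongly[OF assms] by measurable

lemma Lp_space_half_line:
  "f \<in> Lp_space (half_line_measure \<gamma>) p \<longleftrightarrow> strongly_measurable half_line f \<and>
    (\<integral>\<^sup>+x. ennreal (x powr \<gamma> * norm (f x) powr p) \<partial>half_line) < \<infinity>"
  by (auto simp: Lp_space_def nn_integral_half_line_measure borel_measurable_norm_powr)

lemma nn_integral_le_Lp_norm:
  assumes "f \<in> Lp_space (half_line_measure \<gamma>) p" "Lp_norm (half_line_measure \<gamma>) p f \<le> e" "0 < p"
  shows "(\<integral>\<^sup>+x. ennreal (x powr \<gamma> * norm (f x) powr p) \<partial>half_line) \<le> ennreal (e powr p)"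
proof -
  define I where "I = (\<integral>\<^sup>+x. ennreal (x powr \<gamma> * norm (f x) powr p) \<partial>half_line)"
  have I: "I < \<infinity>" and "strongly_measurable half_line f"
    using assms(1) by (auto simp: Lp_space_half_line I_def)
  then have "enn2real I powr (1 / p) \<le> e"
    using assms(2) by (simp add: Lp_norm_def nn_integral_half_line_measure borel_measurable_norm_powr I_def)
  then have "(enn2real I powr (1 / p)) powr p \<le> e powr p"
    using assms(3) by (intro powr_mono2) auto
  then have "enn2real I \<le> e powr p"
    using assms(3) by (simp add: powr_powr)
  then have "ennreal (enn2real I) \<le> ennreal (e powr p)"
    by (rule ennreal_leI)
  moreover have "ennreal (enn2real I) = I"
    using I by simp
  ultimately show ?thesis
    by (simp only: I_def)
qed

lemma Lp_space_diff:
  assumes f: "f \<in> Lp_space (half_line_measure \<gamma>) p" and g: "g \<in> Lp_space (half_line_measure \<gamma>) p"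
    and p: "0 < p"
  shows "(\<lambda>x. f x - g x) \<in> Lp_space (half_line_measure \<gamma>) p"
proof -
  have sf: "strongly_measurable half_line f" and sg: "strongly_measurable half_line g"
    using f g by (auto simp: Lp_space_half_line)
  have sd: "strongly_measurable half_line (\<lambda>x. f x - g x)"
    using strongly_measurable_lincomb[OF sf sg, of 1] by simp
  have le: "norm (f x - g x) powr p \<le> 2 powr p * (norm (f x) powr p + norm (g x) powr p)" for x
  proof -
    define M where "M = max (norm (f x)) (norm (g x))"
    have "norm (f x - g x) \<le> 2 * M"
      using norm_triangle_ineq4[of "f x" "g x"] by (auto simp: M_def)
    then have "norm (f x - g x) powr p \<le> (2 * M) powr p"
      using p by (intro powr_mono2) auto
    also have "\<dots> = 2 powr p * M powr p"
      by (rule powr_mult)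
    also have "M powr p \<le> norm (f x) powr p + norm (g x) powr p"
      by (auto simp: M_def max_def)
    finally show ?thesis by simp
  qed
  have m: "(\<lambda>x. x powr \<gamma> * norm (h x) powr p) \<in> borel_measurable half_line"
    if "strongly_measurable half_line h" for h :: "real \<Rightarrow> 'a"
  proof -
    have "(\<lambda>x. x powr \<gamma>) \<in> borel_measurable half_line"
      by (rule borel_measurable_half_line) measurable
    then show ?thesis
      using borel_measurable_norm_powr[OF that, of p] by measurable
  qed
  note mm[measurable] = m[OF sf] m[OF sg]
  have "(\<integral>\<^sup>+x. ennreal (x powr \<gamma> * norm (f x - g x) powr p) \<partial>half_line)
    \<le> (\<integral>\<^sup>+x. ennreal (2 powr p) * (ennreal (x powr \<gamma> * norm (f x) powr p)
        + ennreal (x powr \<gamma> * norm (g x) powr p)) \<partial>half_line)"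
  proof (intro nn_integral_mono)
    fix x
    have "x powr \<gamma> * norm (f x - g x) powr p
        \<le> x powr \<gamma> * (2 powr p * (norm (f x) powr p + norm (g x) powr p))"
      by (intro mult_left_mono le) auto
    also have "\<dots> = 2 powr p * (x powr \<gamma> * norm (f x) powr p + x powr \<gamma> * norm (g x) powr p)"
      by (simp add: algebra_simps)
    finally show "ennreal (x powr \<gamma> * norm (f x - g x) powr p)
      \<le> ennreal (2 powr p) * (ennreal (x powr \<gamma> * norm (f x) powr p)
        + ennreal (x powr \<gamma> * norm (g x) powr p))"
      by (simp flip: ennreal_plus ennreal_mult' add: ennreal_leI)
  qed
  also have "\<dots> = ennreal (2 powr p) * ((\<integral>\<^sup>+x. ennreal (x powr \<gamma> * norm (f x) powr p) \<partial>half_line)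
      + (\<integral>\<^sup>+x. ennreal (x powr \<gamma> * norm (g x) powr p) \<partial>half_line))"
    by (simp add: nn_integral_cmult nn_integral_add)
  also have "\<dots> < \<infinity>"
    using f g by (simp add: Lp_space_half_line ennreal_mult_less_top)
  finally show ?thesis
    using sd by (simp add: Lp_space_half_line)
qed

lemma strongly_measurable_test_scaleR:
  assumes "f \<in> Lp_space (half_line_measure \<gamma>) p"
  shows "strongly_measurable half_line (\<lambda>x. test_apply \<phi> x *\<^sub>R f x)"
  using assms
  by (auto simp: Lp_space_half_line intro!: strongly_measurable_scaleR borel_measurable_half_line)

text \<open>
  On the support of the test function the weight is bounded from below, and
  \<open>\<parallel>f\<parallel> \<le> 1 + \<parallel>f\<parallel>^p\<close>.
\<close>

lemma nn_integral_test_scaleR_finite: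
  assumes f: "f \<in> Lp_space (half_line_measure \<gamma>) p" and p: "1 < p"
  shows "(\<integral>\<^sup>+x. ennreal (norm (test_apply \<phi> x *\<^sub>R f x)) \<partial>half_line) < \<infinity>"
proof -
  obtain a b where a: "0 < a" and ab: "\<And>x. x \<notin> {a..b} \<Longrightarrow> test_apply \<phi> x = 0"
    using test_apply_support by blast
  have "bounded (test_apply \<phi> ` {a..b})"
    by (intro compact_imp_bounded compact_continuous_image continuous_intros compact_Icc)
  then obtain K where K: "\<And>x. x \<in> {a..b} \<Longrightarrow> \<bar>test_apply \<phi> x\<bar> \<le> K"
    unfolding bounded_iff by fastforce
  have "bounded ((\<lambda>x. x powr - \<gamma>) ` {a..b})"
    using a by (intro compact_imp_bounded compact_continuous_image continuous_intros compact_Icc) auto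
  then obtain L where L: "\<And>x. x \<in> {a..b} \<Longrightarrow> x powr - \<gamma> \<le> L"
    unfolding bounded_iff by fastforce
  define K' where "K' = max K 0"
  define L' where "L' = max L 0"
  have KL: "0 \<le> K'" "0 \<le> L'" by (auto simp: K'_def L'_def)
  have m: "(\<lambda>x. x powr \<gamma> * norm (f x) powr p) \<in> borel_measurable half_line"
  proof -
    have "(\<lambda>x. x powr \<gamma>) \<in> borel_measurable half_line"
      by (rule borel_measurable_half_line) measurable
    then show ?thesis
      using f borel_measurable_norm_powr[of half_line f p] by (auto simp: Lp_space_half_line)
  qed
  have i: "(\<lambda>x. indicator {a..b} x :: real) \<in> borel_measurable half_line"
    by (rule borel_measurable_half_line) measurable
  note [measurable] = m i
  have "(\<integral>\<^sup>+x. ennreal (norm (test_apply \<phi> x *\<^sub>R f x)) \<partial>half_line)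
    \<le> (\<integral>\<^sup>+x. ennreal K' * ennreal (indicator {a..b} x)
      + ennreal (K' * L') * ennreal (x powr \<gamma> * norm (f x) powr p) \<partial>half_line)"
  proof (intro nn_integral_mono)
    fix x
    have "norm (test_apply \<phi> x *\<^sub>R f x)
      \<le> K' * indicator {a..b} x + (K' * L') * (x powr \<gamma> * norm (f x) powr p)"
    proof (cases "x \<in> {a..b}")
      case True
      have "norm (f x) \<le> 1 + norm (f x) powr p"
      proof (cases "norm (f x) \<le> 1")
        case False
        then have "norm (f x) powr 1 \<le> norm (f x) powr p"
          using p by (intro powr_mono) auto
        then show ?thesis using False by simp
      qed (simp add: add_increasing2)
      also have "norm (f x) powr p = x powr - \<gamma> * (x powr \<gamma> * norm (f x) powr p)"
        using True a by (simp add: powr_minus)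
      also have "\<dots> \<le> L' * (x powr \<gamma> * norm (f x) powr p)"
        using L[OF True] by (intro mult_right_mono) (auto simp: L'_def)
      finally have "norm (f x) \<le> 1 + L' * (x powr \<gamma> * norm (f x) powr p)" by simp
      moreover have "\<bar>test_apply \<phi> x\<bar> \<le> K'" using K[OF True] by (simp add: K'_def)
      ultimately have "\<bar>test_apply \<phi> x\<bar> * norm (f x) \<le> K' * (1 + L' * (x powr \<gamma> * norm (f x) powr p))"
        by (intro mult_mono) (auto simp: K'_def)
      then show ?thesis using True by (simp add: algebra_simps)
    qed (use ab[of x] in \<open>auto simp: K'_def L'_def\<close>)
    then show "ennreal (norm (test_apply \<phi> x *\<^sub>R f x)) \<le> ennreal K' * ennreal (indicator {a..b} x)
      + ennreal (K' * L') * ennreal (x powr \<gamma> * norm (f x) powr p)"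
      by (simp flip: ennreal_plus ennreal_mult' add: ennreal_leI KL)
  qed
  also have "\<dots> = ennreal K' * (\<integral>\<^sup>+x. ennreal (indicator {a..b} x) \<partial>half_line)
      + ennreal (K' * L') * (\<integral>\<^sup>+x. ennreal (x powr \<gamma> * norm (f x) powr p) \<partial>half_line)"
    by (simp add: nn_integral_cmult nn_integral_add)
  also have "\<dots> < \<infinity>"
  proof -
    have "(\<integral>\<^sup>+x. ennreal (indicator {a..b} x) \<partial>half_line)
      = (\<integral>\<^sup>+x. ennreal (indicator {a..b} x) * indicator {0<..} x \<partial>lborel)"
      by (rule nn_integral_half_line_lborel) measurable
    also have "\<dots> \<le> (\<integral>\<^sup>+x. indicator {a..b} x \<partial>lborel)"
      by (intro nn_integral_mono) (auto simp: indicator_def)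
    also have "\<dots> < \<infinity>"
      by (cases "a \<le> b") auto
    finally show ?thesis
      using f by (simp add: Lp_space_half_line ennreal_mult_less_top)
  qed
  finally show ?thesis .
qed

lemma regular_distr_diff:
  assumes "f \<in> Lp_space (half_line_measure \<gamma>) p" "g \<in> Lp_space (half_line_measure \<gamma>) p" "1 < p"
  shows "regular_distr (\<lambda>x. f x - g x) = regular_distr f - regular_distr g"
proof
  fix \<phi>
  show "regular_distr (\<lambda>x. f x - g x) \<phi> = (regular_distr f - regular_distr g) \<phi>"
    using bochner_int_lincomb[OF strongly_measurable_test_scaleR[OF assms(1), of \<phi>]
        nn_integral_test_scaleR_finite[OF assms(1,3)] strongly_measurable_test_scaleR[OF assms(2), of \<phi>]
        nn_integral_test_scaleR_finite[OF assms(2,3)], of 1]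
    by (simp add: regular_distr_def scaleR_diff_right fun_diff_def)
qed

lemma regular_distr_lincomb:
  assumes f: "f \<in> Lp_space (half_line_measure \<gamma>) p" and p: "1 < p"
    and \<Psi>: "\<And>x. test_apply \<Psi> x = test_apply \<psi> x - c * test_apply \<theta> x"
  shows "regular_distr f \<Psi> = regular_distr f \<psi> - c *\<^sub>R regular_distr f \<theta>"
proof -
  have "test_apply \<Psi> x *\<^sub>R f x = test_apply \<psi> x *\<^sub>R f x - c *\<^sub>R (test_apply \<theta> x *\<^sub>R f x)" for x
    by (simp add: \<Psi> algebra_simps)
  then show ?thesis
    unfolding regular_distr_def
    using bochner_int_lincomb[OF strongly_measurable_test_scaleR[OF f, of \<psi>]
        nn_integral_test_scaleR_finite[OF f p] strongly_measurable_test_scaleR[OF f, of \<theta>]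
        nn_integral_test_scaleR_finite[OF f p], of c]
    by simp
qed

text \<open>
  A pointwise substitute for Hoelder's inequality: where \<open>t \<le> e x^-s\<close> the first term suffices,
  elsewhere \<open>t \<le> (e x^-s)^(1-p) t^p\<close>. The exponent \<open>s\<close> is the one for which the second term carries
  exactly the weight \<open>x^\<gamma>\<close>.
\<close>

lemma powr_split_le:
  fixes x t s p \<gamma> e :: real
  assumes "0 < x" "0 < e" "0 \<le> t" "1 < p" and s: "real j + s * (p - 1) = \<gamma>"
  shows "x ^ j * t \<le> e * x powr (real j - s) + e powr (1 - p) * (x powr \<gamma> * t powr p)"
proof (cases "t \<le> e * x powr (- s)")
  case True
  then have "x ^ j * t \<le> x ^ j * (e * x powr (- s))"
    using assms by (intro mult_left_mono) auto
  also have "\<dots> = e * x powr (real j - s)"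
    using assms(1) by (simp add: powr_diff powr_minus powr_realpow field_simps)
  finally show ?thesis
    using assms by (simp add: add_increasing2)
next
  case False
  define u where "u = e * x powr (- s)"
  have u: "0 < u" "u < t" using False assms by (auto simp: u_def)
  then have "u powr (p - 1) \<le> t powr (p - 1)"
    using assms by (intro powr_mono2) auto
  then have "1 \<le> u powr (1 - p) * t powr (p - 1)"
    using u by (simp add: powr_diff field_simps)
  then have "t \<le> u powr (1 - p) * t powr (p - 1) * t"
    using u by simp
  also have "\<dots> = u powr (1 - p) * t powr p"
    using u by (simp add: powr_diff)
  also have "u powr (1 - p) = e powr (1 - p) * x powr (s * (p - 1))"
    using assms unfolding u_def by (simp add: powr_mult powr_powr algebra_simps)
  finally have "x ^ j * t \<le> x ^ j * (e powr (1 - p) * x powr (s * (p - 1)) * t powr p)"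
    using assms by (intro mult_left_mono) auto
  also have "\<dots> = e powr (1 - p) * (x powr (real j + s * (p - 1)) * t powr p)"
    using assms(1) by (simp add: powr_add powr_realpow)
  finally show ?thesis
    using assms by (simp add: s add_increasing)
qed

text \<open>
  A test function dominated by \<open>x^j\<close> on \<open>(0, 1]\<close> pairs boundedly with \<open>L^p(w_\<gamma>)\<close>, as
  \<open>powr_split_le\<close> shows: with \<open>s = (\<gamma> - j) / (p - 1)\<close> the remaining power \<open>x^(j-s)\<close> is integrable
  at \<open>0\<close> precisely because \<open>\<gamma> + 1 < (j + 1) p\<close>. The powers \<open>e^(1-p)\<close> and \<open>e^p\<close> multiply to \<open>e\<close>, which makes the
  bound linear in \<open>e\<close>.
\<close>

lemma norm_regular_distr_le_Lp_norm:
  assumes f: "f \<in> Lp_space (half_line_measure \<gamma>) p" and fe: "Lp_norm (half_line_measure \<gamma>) p f \<le> e"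
    and p: "1 < p" and e: "0 < e" and C: "0 \<le> C" and \<gamma>: "\<gamma> + 1 < (real j + 1) * p"
    and supp: "\<And>x. 1 < x \<Longrightarrow> test_apply \<psi> x = 0"
    and le: "\<And>x. 0 \<le> x \<Longrightarrow> x \<le> 1 \<Longrightarrow> \<bar>test_apply \<psi> x\<bar> \<le> C * x ^ j"
  shows "norm (regular_distr f \<psi>) \<le> C * (1 + 1 / (real j - (\<gamma> - real j) / (p - 1) + 1)) * e"
proof -
  define s where "s = (\<gamma> - real j) / (p - 1)"
  have s: "real j + s * (p - 1) = \<gamma>" using p by (simp add: s_def)
  have js: "-1 < real j - s"
  proof -
    have "\<gamma> - real j < (real j + 1) * (p - 1)" using \<gamma> by (simp add: algebra_simps)
    then have "s < real j + 1" using p by (simp add: s_def pos_divide_less_eq)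
    then show ?thesis by simp
  qed
  have m: "(\<lambda>x. x powr \<gamma> * norm (f x) powr p) \<in> borel_measurable half_line"
  proof -
    have "(\<lambda>x. x powr \<gamma>) \<in> borel_measurable half_line"
      by (rule borel_measurable_half_line) measurable
    then show ?thesis
      using f borel_measurable_norm_powr[of half_line f p] by (auto simp: Lp_space_half_line)
  qed
  have i: "(\<lambda>x. if x \<le> 1 then x powr (real j - s) else 0 :: real) \<in> borel_measurable half_line"
    by (rule borel_measurable_half_line) measurable
  note [measurable] = m i
  have "(\<integral>\<^sup>+x. ennreal (norm (test_apply \<psi> x *\<^sub>R f x)) \<partial>half_line)
    \<le> (\<integral>\<^sup>+x. ennreal C * (ennreal e * ennreal (if x \<le> 1 then x powr (real j - s) else 0)
      + ennreal (e powr (1 - p)) * ennreal (x powr \<gamma> * norm (f x) powr p)) \<partial>half_line)"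
  proof (intro nn_integral_mono)
    fix x assume "x \<in> space half_line"
    then have x: "0 < x" by simp
    have "norm (test_apply \<psi> x *\<^sub>R f x) \<le> C * (e * (if x \<le> 1 then x powr (real j - s) else 0)
      + e powr (1 - p) * (x powr \<gamma> * norm (f x) powr p))"
    proof (cases "x \<le> 1")
      case True
      have "\<bar>test_apply \<psi> x\<bar> * norm (f x) \<le> (C * x ^ j) * norm (f x)"
        using le[of x] x True by (intro mult_right_mono) auto
      also have "\<dots> = C * (x ^ j * norm (f x))" by simp
      also have "\<dots> \<le> C * (e * x powr (real j - s) + e powr (1 - p) * (x powr \<gamma> * norm (f x) powr p))"
        by (intro mult_left_mono powr_split_le x e p s C) auto
      finally show ?thesis using True by simp
    next
      case False
      then show ?thesis using supp[of x] C e by simp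
    qed
    then show "ennreal (norm (test_apply \<psi> x *\<^sub>R f x)) \<le> ennreal C * (ennreal e * ennreal (if x \<le> 1 then x powr (real j - s) else 0)
      + ennreal (e powr (1 - p)) * ennreal (x powr \<gamma> * norm (f x) powr p))"
      using C e by (simp flip: ennreal_plus ennreal_mult' ennreal_mult add: ennreal_leI)
  qed
  also have "\<dots> = ennreal C * (ennreal e * ennreal (1 / (real j - s + 1))
      + ennreal (e powr (1 - p)) * (\<integral>\<^sup>+x. ennreal (x powr \<gamma> * norm (f x) powr p) \<partial>half_line))"
    by (simp add: nn_integral_cmult nn_integral_add nn_integral_powr_half_line[OF js])
  also have "\<dots> \<le> ennreal C * (ennreal e * ennreal (1 / (real j - s + 1))
      + ennreal (e powr (1 - p)) * ennreal (e powr p))"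
    using p by (intro mult_left_mono add_left_mono nn_integral_le_Lp_norm[OF f fe]) auto
  also have "\<dots> = ennreal (C * (1 + 1 / (real j - s + 1)) * e)"
  proof -
    have "e powr (1 - p) * e powr p = e" using e by (simp flip: powr_add)
    then have "C * (e * (1 / (real j - s + 1)) + e powr (1 - p) * e powr p) = C * (1 + 1 / (real j - s + 1)) * e"
      by (simp add: algebra_simps)
    then show ?thesis
      using C e js by (simp flip: ennreal_plus ennreal_mult' ennreal_mult)
  qed
  finally show ?thesis
    unfolding regular_distr_def s_def[symmetric]
    by (rule norm_bochner_int_le) (use C e js in simp)
qed

section \<open>Boundedness of the trace functional\<close>

text \<open>
  One integration by parts: \<open>\<psi> = c \<theta> + \<Psi>'\<close>, the derivative is moved to the distribution, and
  the pairing with the fixed bump \<open>\<theta>\<close> is absorbed by \<open>L e\<close>. The exponents \<open>N\<close> and \<open>j\<close> are independent because \<open>\<theta>\<close>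
  vanishes near \<open>0\<close> and is hence dominated by every power of \<open>x\<close>.
\<close>

lemma norm_regular_distr_le_deriv:
  assumes p: "1 < p" and \<gamma>: "\<gamma> + 1 < (real N + 1) * p" and C: "0 \<le> C"
  obtains L where "\<And>(f :: real \<Rightarrow> 'a::banach) e \<psi>. 0 < e \<Longrightarrow>
    f \<in> Lp_space (half_line_measure \<gamma>) p \<Longrightarrow> Lp_norm (half_line_measure \<gamma>) p f \<le> e \<Longrightarrow>
    (\<And>x. 1 < x \<Longrightarrow> test_apply \<psi> x = 0) \<Longrightarrow>
    (\<And>x. 0 \<le> x \<Longrightarrow> x \<le> 1 \<Longrightarrow> integral {0..x} (\<lambda>y. \<bar>test_apply \<psi> y\<bar>) \<le> C * x ^ j) \<Longrightarrow>
    \<exists>\<Psi>. (\<forall>x>1. test_apply \<Psi> x = 0) \<and>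
      (\<forall>x. 0 \<le> x \<longrightarrow> x \<le> 1 \<longrightarrow> \<bar>test_apply \<Psi> x\<bar> \<le> C * (1 + 2 ^ j) * x ^ j) \<and>
      norm (regular_distr f \<psi>) \<le> norm (distr_deriv (regular_distr f) \<Psi>) + L * e"
proof -
  define G where "G = 1 + 1 / (real N - (\<gamma> - real N) / (p - 1) + 1)"
  obtain \<theta> where \<theta>: "\<And>x. 0 \<le> test_apply \<theta> x" "\<And>x. x \<notin> {1/2..1} \<Longrightarrow> test_apply \<theta> x = 0"
      "integral {1/2..1} (test_apply \<theta>) = 1"
    by (rule normalized_test_fun[of "1/2" 1]) auto
  obtain K where K: "0 \<le> K" "\<And>x. 0 \<le> x \<Longrightarrow> \<bar>test_apply \<theta> x\<bar> \<le> K * x ^ N"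
    using test_fun_dominated[OF \<theta>(2)] by blast
  show ?thesis
  proof (rule that[of "C * K * G"])
    fix f :: "real \<Rightarrow> 'a" and e :: real and \<psi>
    assume e: "0 < e" and f: "f \<in> Lp_space (half_line_measure \<gamma>) p"
        "Lp_norm (half_line_measure \<gamma>) p f \<le> e"
      and supp: "\<And>x. 1 < x \<Longrightarrow> test_apply \<psi> x = 0"
      and le: "\<And>x. 0 \<le> x \<Longrightarrow> x \<le> 1 \<Longrightarrow> integral {0..x} (\<lambda>y. \<bar>test_apply \<psi> y\<bar>) \<le> C * x ^ j"
    let ?S = "regular_distr f"
    obtain \<Psi> c where \<Psi>: "\<bar>c\<bar> \<le> C"
      "\<And>x. test_apply (test_deriv \<Psi>) x = test_apply \<psi> x - c * test_apply \<theta> x"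
      "\<And>x. 1 < x \<Longrightarrow> test_apply \<Psi> x = 0"
      "\<And>x. 0 \<le> x \<Longrightarrow> x \<le> 1 \<Longrightarrow> \<bar>test_apply \<Psi> x\<bar> \<le> C * (1 + 2 ^ j) * x ^ j"
      by (rule test_fun_decomposition[of \<theta> \<psi> C j, OF \<theta> supp le]) blast+
    have "?S (test_deriv \<Psi>) = ?S \<psi> - c *\<^sub>R ?S \<theta>"
      by (rule regular_distr_lincomb[OF f(1) p \<Psi>(2)])
    then have "?S \<psi> = c *\<^sub>R ?S \<theta> - distr_deriv ?S \<Psi>"
      by (simp add: distr_deriv_def)
    then have "norm (?S \<psi>) \<le> norm (c *\<^sub>R ?S \<theta>) + norm (distr_deriv ?S \<Psi>)"
      by (metis norm_triangle_ineq4)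
    moreover have "norm (?S \<theta>) \<le> K * G * e"
      unfolding G_def
      by (rule norm_regular_distr_le_Lp_norm[OF f p e K(1) \<gamma>]) (use K \<theta>(2) in auto)
    then have "norm (c *\<^sub>R ?S \<theta>) \<le> C * (K * G * e)"
      using \<Psi>(1) C by (simp add: mult_mono)
    ultimately have "norm (?S \<psi>) \<le> norm (distr_deriv ?S \<Psi>) + C * K * G * e"
      by (simp add: mult.assoc)
    then show "\<exists>\<Psi>. (\<forall>x>1. test_apply \<Psi> x = 0) \<and>
      (\<forall>x. 0 \<le> x \<longrightarrow> x \<le> 1 \<longrightarrow> \<bar>test_apply \<Psi> x\<bar> \<le> C * (1 + 2 ^ j) * x ^ j) \<and>
      norm (?S \<psi>) \<le> norm (distr_deriv ?S \<Psi>) + C * K * G * e"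
      using \<Psi>(3,4) by blast
  qed
qed

text \<open>
  Induction on the number of derivatives that are still available. Every step trades one derivative of
  \<open>S\<close> for one power of \<open>x\<close>; the sum \<open>j + n\<close>, which is the exponent reached when the derivatives
  are used up, stays constant. The hypothesis on \<open>\<psi>\<close> is
  on the integrals of \<open>\<bar>\<psi>\<bar>\<close> and not pointwise, since for \<open>j = 0\<close> it has to hold uniformly
  for bumps that concentrate at \<open>0\<close>.
\<close>

lemma norm_distr_le_Lp_norms:
  assumes p: "1 < p" and "\<gamma> + 1 < (real (j + n) + 1) * p" and "0 \<le> C"
  shows "\<exists>L. \<forall>(S :: 'a::banach distr) e \<psi>. 0 < e \<longrightarrow>
    (\<forall>i\<le>Suc n. \<exists>f\<in>Lp_space (half_line_measure \<gamma>) p.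
      (distr_deriv ^^ i) S = regular_distr f \<and> Lp_norm (half_line_measure \<gamma>) p f \<le> e) \<longrightarrow>
    (\<forall>x>1. test_apply \<psi> x = 0) \<longrightarrow>
    (\<forall>x. 0 \<le> x \<longrightarrow> x \<le> 1 \<longrightarrow> integral {0..x} (\<lambda>y. \<bar>test_apply \<psi> y\<bar>) \<le> C * x ^ j) \<longrightarrow>
    norm (S \<psi>) \<le> L * e"
  using assms(2,3)
proof (induction n arbitrary: j C)
  case 0
  define G where "G = 1 + 1 / (real j - (\<gamma> - real j) / (p - 1) + 1)"
  have \<gamma>: "\<gamma> + 1 < (real j + 1) * p" using 0 by simp
  obtain L where L: "\<And>(f :: real \<Rightarrow> 'a) e \<psi>. 0 < e \<Longrightarrow>
    f \<in> Lp_space (half_line_measure \<gamma>) p \<Longrightarrow> Lp_norm (half_line_measure \<gamma>) p f \<le> e \<Longrightarrow>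
    (\<And>x. 1 < x \<Longrightarrow> test_apply \<psi> x = 0) \<Longrightarrow>
    (\<And>x. 0 \<le> x \<Longrightarrow> x \<le> 1 \<Longrightarrow> integral {0..x} (\<lambda>y. \<bar>test_apply \<psi> y\<bar>) \<le> C * x ^ j) \<Longrightarrow>
    \<exists>\<Psi>. (\<forall>x>1. test_apply \<Psi> x = 0) \<and>
      (\<forall>x. 0 \<le> x \<longrightarrow> x \<le> 1 \<longrightarrow> \<bar>test_apply \<Psi> x\<bar> \<le> C * (1 + 2 ^ j) * x ^ j) \<and>
      norm (regular_distr f \<psi>) \<le> norm (distr_deriv (regular_distr f) \<Psi>) + L * e"
    using norm_regular_distr_le_deriv[OF p \<gamma> 0(2)] by blast
  show ?case
  proof (intro exI[of _ "C * (1 + 2 ^ j) * G + L"] allI impI)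
    fix S :: "'a distr" and e :: real and \<psi>
    assume e: "0 < e" and S: "\<forall>i\<le>Suc 0. \<exists>f\<in>Lp_space (half_line_measure \<gamma>) p.
        (distr_deriv ^^ i) S = regular_distr f \<and> Lp_norm (half_line_measure \<gamma>) p f \<le> e"
      and supp: "\<forall>x>1. test_apply \<psi> x = 0"
      and le: "\<forall>x. 0 \<le> x \<longrightarrow> x \<le> 1 \<longrightarrow> integral {0..x} (\<lambda>y. \<bar>test_apply \<psi> y\<bar>) \<le> C * x ^ j"
    obtain f where f: "f \<in> Lp_space (half_line_measure \<gamma>) p" "S = regular_distr f"
        "Lp_norm (half_line_measure \<gamma>) p f \<le> e"
      using S[rule_format, of 0] by auto
    obtain g where g: "g \<in> Lp_space (half_line_measure \<gamma>) p" "distr_deriv S = regular_distr g"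
        "Lp_norm (half_line_measure \<gamma>) p g \<le> e"
      using S[rule_format, of 1] by auto
    obtain \<Psi> where \<Psi>: "\<And>x. 1 < x \<Longrightarrow> test_apply \<Psi> x = 0"
      "\<And>x. 0 \<le> x \<Longrightarrow> x \<le> 1 \<Longrightarrow> \<bar>test_apply \<Psi> x\<bar> \<le> C * (1 + 2 ^ j) * x ^ j"
      "norm (S \<psi>) \<le> norm (distr_deriv S \<Psi>) + L * e"
      using L[OF e f(1,3), of \<psi>] supp le unfolding f(2) by blast
    have "norm (distr_deriv S \<Psi>) \<le> C * (1 + 2 ^ j) * G * e"
      unfolding g(2) G_def
      by (rule norm_regular_distr_le_Lp_norm[OF g(1,3) p e _ \<gamma>]) (use \<Psi> 0(2) in auto)
    then show "norm (S \<psi>) \<le> (C * (1 + 2 ^ j) * G + L) * e"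
      using \<Psi>(3) by (simp add: algebra_simps)
  qed
next
  case (Suc n)
  define C' where "C' = C * (1 + 2 ^ j)"
  have C': "0 \<le> C'" using Suc.prems by (simp add: C'_def)
  have "\<gamma> + 1 < (real (Suc j + n) + 1) * p" using Suc.prems by simp
  from Suc.IH[OF this C'] obtain L' where L': "\<And>(S :: 'a distr) e \<psi>. 0 < e \<Longrightarrow>
    (\<forall>i\<le>Suc n. \<exists>f\<in>Lp_space (half_line_measure \<gamma>) p.
      (distr_deriv ^^ i) S = regular_distr f \<and> Lp_norm (half_line_measure \<gamma>) p f \<le> e) \<Longrightarrow>
    (\<forall>x>1. test_apply \<psi> x = 0) \<Longrightarrow>
    (\<forall>x. 0 \<le> x \<longrightarrow> x \<le> 1 \<longrightarrow> integral {0..x} (\<lambda>y. \<bar>test_apply \<psi> y\<bar>) \<le> C' * x ^ Suc j) \<Longrightarrow>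
    norm (S \<psi>) \<le> L' * e"
    by blast
  obtain L where L: "\<And>(f :: real \<Rightarrow> 'a) e \<psi>. 0 < e \<Longrightarrow>
    f \<in> Lp_space (half_line_measure \<gamma>) p \<Longrightarrow> Lp_norm (half_line_measure \<gamma>) p f \<le> e \<Longrightarrow>
    (\<And>x. 1 < x \<Longrightarrow> test_apply \<psi> x = 0) \<Longrightarrow>
    (\<And>x. 0 \<le> x \<Longrightarrow> x \<le> 1 \<Longrightarrow> integral {0..x} (\<lambda>y. \<bar>test_apply \<psi> y\<bar>) \<le> C * x ^ j) \<Longrightarrow>
    \<exists>\<Psi>. (\<forall>x>1. test_apply \<Psi> x = 0) \<and>
      (\<forall>x. 0 \<le> x \<longrightarrow> x \<le> 1 \<longrightarrow> \<bar>test_apply \<Psi> x\<bar> \<le> C' * x ^ j) \<and>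
      norm (regular_distr f \<psi>) \<le> norm (distr_deriv (regular_distr f) \<Psi>) + L * e"
    using norm_regular_distr_le_deriv[OF p Suc.prems] unfolding C'_def by blast
  show ?case
  proof (intro exI[of _ "L' + L"] allI impI)
    fix S :: "'a distr" and e :: real and \<psi>
    assume e: "0 < e" and S: "\<forall>i\<le>Suc (Suc n). \<exists>f\<in>Lp_space (half_line_measure \<gamma>) p.
        (distr_deriv ^^ i) S = regular_distr f \<and> Lp_norm (half_line_measure \<gamma>) p f \<le> e"
      and supp: "\<forall>x>1. test_apply \<psi> x = 0"
      and le: "\<forall>x. 0 \<le> x \<longrightarrow> x \<le> 1 \<longrightarrow> integral {0..x} (\<lambda>y. \<bar>test_apply \<psi> y\<bar>) \<le> C * x ^ j"
    obtain f where f: "f \<in> Lp_space (half_line_measure \<gamma>) p" "S = regular_distr f"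
        "Lp_norm (half_line_measure \<gamma>) p f \<le> e"
      using S[rule_format, of 0] by auto
    obtain \<Psi> where \<Psi>: "\<forall>x>1. test_apply \<Psi> x = 0"
      "\<And>x. 0 \<le> x \<Longrightarrow> x \<le> 1 \<Longrightarrow> \<bar>test_apply \<Psi> x\<bar> \<le> C' * x ^ j"
      "norm (S \<psi>) \<le> norm (distr_deriv S \<Psi>) + L * e"
      using L[OF e f(1,3), of \<psi>] supp le unfolding f(2) by blast
    have "norm (distr_deriv S \<Psi>) \<le> L' * e"
    proof (rule L'[OF e])
      show "\<forall>i\<le>Suc n. \<exists>f\<in>Lp_space (half_line_measure \<gamma>) p.
        (distr_deriv ^^ i) (distr_deriv S) = regular_distr f \<and> Lp_norm (half_line_measure \<gamma>) p f \<le> e"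
      proof (intro allI impI)
        fix i assume "i \<le> Suc n"
        then show "\<exists>f\<in>Lp_space (half_line_measure \<gamma>) p.
          (distr_deriv ^^ i) (distr_deriv S) = regular_distr f \<and> Lp_norm (half_line_measure \<gamma>) p f \<le> e"
          using S[rule_format, of "Suc i"] by (simp add: funpow_swap1)
      qed
      show "\<forall>x. 0 \<le> x \<longrightarrow> x \<le> 1 \<longrightarrow> integral {0..x} (\<lambda>y. \<bar>test_apply \<Psi> y\<bar>) \<le> C' * x ^ Suc j"
      proof (intro allI impI)
        fix x :: real assume x: "0 \<le> x" "x \<le> 1"
        have "integral {0..x} (\<lambda>y. \<bar>test_apply \<Psi> y\<bar>) \<le> integral {0..x} (\<lambda>_. C' * x ^ j)"
        proof (intro integral_le)
          fix y assume y: "y \<in> {0..x}"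
          then have "\<bar>test_apply \<Psi> y\<bar> \<le> C' * y ^ j" using \<Psi>(2)[of y] x by auto
          also have "\<dots> \<le> C' * x ^ j" using y C' by (intro mult_left_mono power_mono) auto
          finally show "\<bar>test_apply \<Psi> y\<bar> \<le> C' * x ^ j" .
        qed auto
        then show "integral {0..x} (\<lambda>y. \<bar>test_apply \<Psi> y\<bar>) \<le> C' * x ^ Suc j"
          using x by (simp add: algebra_simps)
      qed
    qed (use \<Psi>(1) in auto)
    then show "norm (S \<psi>) \<le> (L' + L) * e"
      using \<Psi>(3) by (simp add: algebra_simps)
  qed
qed

lemma distr_deriv_funpow_diff:
  fixes T U :: "'a::banach distr"
  shows "(distr_deriv ^^ n) (T - U) = (distr_deriv ^^ n) T - (distr_deriv ^^ n) U"
proof (induction n)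
  case (Suc n)
  then show ?case by (auto simp: distr_deriv_def fun_eq_iff)
qed simp

lemma sobolev_mono: "l \<le> k \<Longrightarrow> sobolev k p \<gamma> \<subseteq> sobolev l p \<gamma>"
  by (fastforce simp: sobolev_def)

lemma distr_Lp_norm_le_sobolev_norm:
  assumes "i \<le> k"
  shows "distr_Lp_norm p \<gamma> ((distr_deriv ^^ i) T) \<le> sobolev_norm k p \<gamma> T"
  unfolding sobolev_norm_def
  using assms by (intro member_le_sum) (auto simp: distr_Lp_norm_def Lp_norm_def)

lemma sobolev_diff:
  assumes "T \<in> sobolev k p \<gamma>" "U \<in> sobolev k p \<gamma>" "1 < p"
  shows "T - U \<in> sobolev k p \<gamma>"
proof -
  have "\<exists>f\<in>Lp_space (half_line_measure \<gamma>) p. (distr_deriv ^^ i) (T - U) = regular_distr f" if "i \<le> k" for i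
  proof -
    obtain f g where "f \<in> Lp_space (half_line_measure \<gamma>) p" "(distr_deriv ^^ i) T = regular_distr f"
      "g \<in> Lp_space (half_line_measure \<gamma>) p" "(distr_deriv ^^ i) U = regular_distr g"
      using assms \<open>i \<le> k\<close> unfolding sobolev_def by blast
    then show ?thesis
      using assms(3)
      by (intro bexI[of _ "\<lambda>x. f x - g x"])
        (auto simp: distr_deriv_funpow_diff regular_distr_diff intro!: Lp_space_diff)
  qed
  then show ?thesis by (simp add: sobolev_def)
qed

text \<open>
  The Sobolev norm is evaluated on chosen representatives of the derivatives, and these are
  the ones obtained here.
\<close>

lemma sobolev_representative:
  assumes "T \<in> sobolev k p \<gamma>" "i \<le> k" "sobolev_norm k p \<gamma> T \<le> e"
  obtains f where "f \<in> Lp_space (half_line_measure \<gamma>) p" "(distr_deriv ^^ i) T = regular_distr f"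
    "Lp_norm (half_line_measure \<gamma>) p f \<le> e"
proof -
  define f where "f = (SOME f. f \<in> Lp_space (half_line_measure \<gamma>) p \<and> (distr_deriv ^^ i) T = regular_distr f)"
  have "\<exists>f. f \<in> Lp_space (half_line_measure \<gamma>) p \<and> (distr_deriv ^^ i) T = regular_distr f"
    using assms(1,2) by (auto simp: sobolev_def)
  then have "f \<in> Lp_space (half_line_measure \<gamma>) p \<and> (distr_deriv ^^ i) T = regular_distr f"
    unfolding f_def by (rule someI_ex)
  moreover have "Lp_norm (half_line_measure \<gamma>) p f \<le> e"
    using distr_Lp_norm_le_sobolev_norm[OF assms(2), of p \<gamma> T] assms(3)
    by (simp add: distr_Lp_norm_def f_def)
  ultimately show ?thesis using that by blast
qed

text \<open>
  Boundedness of the trace of the derivative of order \<open>l\<close> on \<open>W^{l+m,p}(w_\<gamma>)\<close>, in the form of a bound on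
  the averages against bumps \<open>\<rho>\<close> that is uniform in \<open>\<rho>\<close>.
\<close>

lemma sobolev_trace_bound:
  assumes p: "1 < p" and \<gamma>: "\<gamma> + 1 < real m * p" and m: "0 < m"
  obtains L where "\<And>(T :: 'a::banach distr) e \<rho>. T \<in> sobolev (l + m) p \<gamma> \<Longrightarrow> 0 < e \<Longrightarrow>
    sobolev_norm (l + m) p \<gamma> T \<le> e \<Longrightarrow> (\<And>x. 0 \<le> test_apply \<rho> x) \<Longrightarrow> (\<And>x. 1 < x \<Longrightarrow> test_apply \<rho> x = 0) \<Longrightarrow>
    integral {0..1} (test_apply \<rho>) \<le> 1 \<Longrightarrow> norm ((distr_deriv ^^ l) T \<rho>) \<le> L * e"
proof -
  obtain n where n: "m = Suc n" using m gr0_conv_Suc by blast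
  have "\<gamma> + 1 < (real (0 + n) + 1) * p" using \<gamma> by (simp add: n algebra_simps)
  from norm_distr_le_Lp_norms[OF p this zero_le_one]
  obtain L where L: "\<And>(S :: 'a distr) e \<psi>. 0 < e \<Longrightarrow>
    (\<forall>i\<le>Suc n. \<exists>f\<in>Lp_space (half_line_measure \<gamma>) p.
      (distr_deriv ^^ i) S = regular_distr f \<and> Lp_norm (half_line_measure \<gamma>) p f \<le> e) \<Longrightarrow>
    (\<forall>x>1. test_apply \<psi> x = 0) \<Longrightarrow>
    (\<forall>x. 0 \<le> x \<longrightarrow> x \<le> 1 \<longrightarrow> integral {0..x} (\<lambda>y. \<bar>test_apply \<psi> y\<bar>) \<le> 1 * x ^ 0) \<Longrightarrow>
    norm (S \<psi>) \<le> L * e"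
    by blast
  show ?thesis
  proof (rule that[of L])
    fix T :: "'a distr" and e :: real and \<rho>
    assume T: "T \<in> sobolev (l + m) p \<gamma>" "sobolev_norm (l + m) p \<gamma> T \<le> e" and e: "0 < e"
      and \<rho>: "\<And>x. 0 \<le> test_apply \<rho> x" "\<And>x. 1 < x \<Longrightarrow> test_apply \<rho> x = 0" "integral {0..1} (test_apply \<rho>) \<le> 1"
    show "norm ((distr_deriv ^^ l) T \<rho>) \<le> L * e"
    proof (rule L[OF e])
      show "\<forall>i\<le>Suc n. \<exists>f\<in>Lp_space (half_line_measure \<gamma>) p.
        (distr_deriv ^^ i) ((distr_deriv ^^ l) T) = regular_distr f \<and> Lp_norm (half_line_measure \<gamma>) p f \<le> e"
      proof (intro allI impI)
        fix i assume "i \<le> Suc n"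
        then have "i + l \<le> l + m" by (simp add: n)
        then obtain f where "f \<in> Lp_space (half_line_measure \<gamma>) p" "(distr_deriv ^^ (i + l)) T = regular_distr f"
          "Lp_norm (half_line_measure \<gamma>) p f \<le> e"
          using sobolev_representative[OF T(1) _ T(2)] by blast
        then show "\<exists>f\<in>Lp_space (half_line_measure \<gamma>) p.
          (distr_deriv ^^ i) ((distr_deriv ^^ l) T) = regular_distr f \<and> Lp_norm (half_line_measure \<gamma>) p f \<le> e"
          by (auto simp: funpow_add)
      qed
      show "\<forall>x. 0 \<le> x \<longrightarrow> x \<le> 1 \<longrightarrow> integral {0..x} (\<lambda>y. \<bar>test_apply \<rho> y\<bar>) \<le> 1 * x ^ 0"
      proof (intro allI impI)
        fix x :: real assume x: "0 \<le> x" "x \<le> 1"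
        have "integral {0..x} (test_apply \<rho>) \<le> integral {0..1} (test_apply \<rho>)"
          using x \<rho>(1) by (intro integral_subset_le) auto
        then show "integral {0..x} (\<lambda>y. \<bar>test_apply \<rho> y\<bar>) \<le> 1 * x ^ 0"
          using \<rho>(1,3) by simp
      qed
    qed (use \<rho>(2) in auto)
  qed
qed

section \<open>The exponential function as a Sobolev function\<close>

lemma regular_distr_exp:
  "regular_distr (\<lambda>x. exp (- x) *\<^sub>R c) \<phi> = (\<integral>x. test_apply \<phi> x * exp (- x) \<partial>half_line) *\<^sub>R c"
proof -
  obtain a b where a: "0 < a" and ab: "\<And>x. x \<notin> {a..b} \<Longrightarrow> test_apply \<phi> x = 0"
    using test_apply_support by blast
  have "integrable half_line (\<lambda>x. test_apply \<phi> x * exp (- x))"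
    by (rule integral_half_line_compact_support(1)[where B = b])
      (use a ab in \<open>auto intro!: continuous_intros\<close>)
  from bochner_int_scaleR_const[OF this, of c] show ?thesis
    by (simp add: regular_distr_def)
qed

text \<open>
  The exponential function is an eigenfunction of the derivative, so a single integration by parts
  provides all its distributional derivatives.
\<close>

lemma distr_deriv_exp:
  "distr_deriv (regular_distr (\<lambda>x. exp (- x) *\<^sub>R c)) = regular_distr (\<lambda>x. exp (- x) *\<^sub>R (- c))"
proof
  fix \<phi>
  obtain a b where a: "0 < a" and ab: "\<And>x. x \<notin> {a..b} \<Longrightarrow> test_apply \<phi> x = 0"
    using test_apply_support by blast
  define B where "B = max 0 b + 1"
  have B: "0 \<le> B" by (simp add: B_def)
  have "B \<notin> {a..b}" by (auto simp: B_def)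
  then have \<phi>B: "test_apply \<phi> B = 0" by (rule ab)
  have out: "test_apply \<phi> x = 0" if "B < x" for x
    by (rule ab) (use that in \<open>auto simp: B_def\<close>)
  have supp': "test_apply (test_deriv \<phi>) x = 0" if "B < x" for x
  proof -
    have "((\<lambda>_. 0) has_field_derivative test_apply (test_deriv \<phi>) x) (at x)"
    proof (rule has_field_derivative_transform_within_open[OF DERIV_test_apply[of \<phi>], of "{B<..}"])
      fix y assume "y \<in> {B<..}"
      then show "test_apply \<phi> y = 0" using out by simp
    qed (use that in auto)
    then show ?thesis by (simp add: DERIV_unique)
  qed
  let ?r = "\<lambda>x. test_apply (test_deriv \<phi>) x * exp (- x)"
  let ?u = "\<lambda>x. test_apply \<phi> x * exp (- x)"
  have "((\<lambda>x. ?r x - ?u x) has_integral ?u B - ?u 0) {0..B}"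
  proof (rule fundamental_theorem_of_calculus[OF B])
    fix x
    have "(?u has_field_derivative ?r x - ?u x) (at x)"
      by (auto intro!: derivative_eq_intros DERIV_test_apply)
    then show "(?u has_vector_derivative ?r x - ?u x) (at x within {0..B})"
      by (auto simp: has_real_derivative_iff_has_vector_derivative intro: has_vector_derivative_at_within)
  qed
  then have "integral {0..B} (\<lambda>x. ?r x - ?u x) = 0"
    using \<phi>B by (auto dest: integral_unique)
  moreover have "integral {0..B} (\<lambda>x. ?r x - ?u x) = integral {0..B} ?r - integral {0..B} ?u"
    by (intro Henstock_Kurzweil_Integration.integral_diff integrable_continuous_interval continuous_intros)
  moreover have "(\<integral>x. ?r x \<partial>half_line) = integral {0..B} ?r"
    by (rule integral_half_line_compact_support(2)) (use supp' in \<open>auto intro!: continuous_intros\<close>)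
  moreover have "(\<integral>x. ?u x \<partial>half_line) = integral {0..B} ?u"
    by (rule integral_half_line_compact_support(2))
      (use out in \<open>auto intro!: continuous_intros\<close>)
  ultimately have "(\<integral>x. ?r x \<partial>half_line) = (\<integral>x. ?u x \<partial>half_line)"
    by simp
  then show "distr_deriv (regular_distr (\<lambda>x. exp (- x) *\<^sub>R c)) \<phi> = regular_distr (\<lambda>x. exp (- x) *\<^sub>R (- c)) \<phi>"
    unfolding distr_deriv_def regular_distr_exp by simp
qed

lemma distr_deriv_funpow_exp:
  "(distr_deriv ^^ n) (regular_distr (\<lambda>x. exp (- x) *\<^sub>R c))
    = regular_distr (\<lambda>x. exp (- x) *\<^sub>R ((- 1) ^ n *\<^sub>R c))"
proof (induction n)
  case (Suc n)
  have "(distr_deriv ^^ Suc n) (regular_distr (\<lambda>x. exp (- x) *\<^sub>R c))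
      = regular_distr (\<lambda>x. exp (- x) *\<^sub>R (- ((- 1) ^ n *\<^sub>R c)))"
    by (simp only: funpow.simps comp_apply Suc distr_deriv_exp)
  then show ?case by simp
qed simp

text \<open>
  The integral is bounded by a value of the Gamma function, as \<open>exp(-p x) \<le> exp(-x)\<close>.
\<close>

lemma exp_in_Lp_space:
  assumes "-1 < \<gamma>" "1 < p"
  shows "(\<lambda>x. exp (- x) *\<^sub>R c) \<in> Lp_space (half_line_measure \<gamma>) p"
proof -
  have "strongly_measurable half_line (\<lambda>x. exp (- x) *\<^sub>R c)"
    by (intro strongly_measurable_scaleR borel_measurable_half_line strongly_measurable_const) measurable
  moreover have "(\<integral>\<^sup>+x. ennreal (x powr \<gamma> * norm (exp (- x) *\<^sub>R c) powr p) \<partial>half_line) < \<infinity>"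
  proof -
    have [measurable]: "(\<lambda>x. x powr \<gamma> * exp (- x)) \<in> borel_measurable half_line"
      by (rule borel_measurable_half_line) measurable
    have "(\<integral>\<^sup>+x. ennreal (x powr \<gamma> * norm (exp (- x) *\<^sub>R c) powr p) \<partial>half_line)
      \<le> (\<integral>\<^sup>+x. ennreal (norm c powr p) * ennreal (x powr \<gamma> * exp (- x)) \<partial>half_line)"
    proof (intro nn_integral_mono)
      fix x assume "x \<in> space half_line"
      then have x: "0 < x" by simp
      have "norm (exp (- x) *\<^sub>R c) powr p = exp (- x) powr p * norm c powr p"
        by (simp add: powr_mult)
      also have "\<dots> \<le> exp (- x) * norm c powr p"
        using x assms by (intro mult_right_mono) (auto simp: powr_def)
      finally have "x powr \<gamma> * norm (exp (- x) *\<^sub>R c) powr p \<le> x powr \<gamma> * (exp (- x) * norm c powr p)"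
        by (intro mult_left_mono) auto
      also have "\<dots> = norm c powr p * (x powr \<gamma> * exp (- x))"
        by (simp add: algebra_simps)
      finally have "x powr \<gamma> * norm (exp (- x) *\<^sub>R c) powr p \<le> norm c powr p * (x powr \<gamma> * exp (- x))" .
      then show "ennreal (x powr \<gamma> * norm (exp (- x) *\<^sub>R c) powr p)
          \<le> ennreal (norm c powr p) * ennreal (x powr \<gamma> * exp (- x))"
        by (simp flip: ennreal_mult' add: ennreal_leI)
    qed
    also have "\<dots> < \<infinity>"
      using nn_integral_exp_powr_half_line[OF assms(1)] by (simp add: nn_integral_cmult ennreal_mult_less_top)
    finally show ?thesis .
  qed
  ultimately show ?thesis by (simp add: Lp_space_half_line)
qed

lemma sobolev_exp:
  assumes "-1 < \<gamma>" "1 < p"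
  shows "regular_distr (\<lambda>x. exp (- x) *\<^sub>R c) \<in> sobolev k p \<gamma>"
  unfolding sobolev_def using exp_in_Lp_space[OF assms] distr_deriv_funpow_exp by blast

section \<open>The domain is not dense\<close>

lemma integral_half_line_normalized:
  assumes \<rho>: "\<And>x. x \<notin> {a..b} \<Longrightarrow> test_apply \<rho> x = 0"
      "integral {a..b} (test_apply \<rho>) = 1" and ab: "0 < a" "a \<le> b"
  shows "integrable half_line (test_apply \<rho>)" "(\<integral>x. test_apply \<rho> x \<partial>half_line) = 1"
    "b \<le> c \<Longrightarrow> integral {0..c} (test_apply \<rho>) = 1"
proof -
  have "integral {0..a} (test_apply \<rho>) = integral {0..a} (\<lambda>_. 0)"
    by (rule integral_spike[of "{a}"]) (use \<rho>(1) in auto)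
  then have i: "integral {0..b} (test_apply \<rho>) = 1"
    using Henstock_Kurzweil_Integration.integral_combine[of 0 a b "test_apply \<rho>"] ab \<rho>(2) by simp
  have *: "test_apply \<rho> x = 0" if "x \<le> 0 \<or> b < x" for x
    using that \<rho>(1)[of x] ab by auto
  show "integrable half_line (test_apply \<rho>)"
    by (rule integral_half_line_compact_support[OF continuous_on_test_apply *])
  show i1: "(\<integral>x. test_apply \<rho> x \<partial>half_line) = 1"
    by (subst integral_half_line_compact_support(2)[OF continuous_on_test_apply *]) (auto simp: i)
  show "integral {0..c} (test_apply \<rho>) = 1" if "b \<le> c"
  proof -
    have "test_apply \<rho> x = 0" if "x \<le> 0 \<or> c < x" for x
      using * that \<open>b \<le> c\<close> by auto
    from integral_half_line_compact_support(2)[OF continuous_on_test_apply this] show ?thesis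
      using i1 by simp
  qed
qed

lemma norm_regular_distr_le_sup:
  assumes \<rho>: "\<And>x. 0 \<le> test_apply \<rho> x" "\<And>x. x \<notin> {a..b} \<Longrightarrow> test_apply \<rho> x = 0"
      "integral {a..b} (test_apply \<rho>) = 1" and ab: "0 < a" "a \<le> b"
    and g: "\<And>x. a \<le> x \<Longrightarrow> x \<le> b \<Longrightarrow> norm (g x) \<le> \<eta>" and \<eta>: "0 \<le> \<eta>"
  shows "norm (regular_distr g \<rho>) \<le> \<eta>"
  unfolding regular_distr_def
proof (rule norm_bochner_int_le)
  note i = integral_half_line_normalized[OF \<rho>(2,3) ab]
  have "(\<integral>\<^sup>+x. ennreal (norm (test_apply \<rho> x *\<^sub>R g x)) \<partial>half_line)
      \<le> (\<integral>\<^sup>+x. ennreal \<eta> * ennreal (test_apply \<rho> x) \<partial>half_line)"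
  proof (intro nn_integral_mono)
    fix x
    have "norm (test_apply \<rho> x *\<^sub>R g x) \<le> \<eta> * test_apply \<rho> x"
      using \<rho>(1)[of x] \<rho>(2)[of x] g[of x] by (cases "x \<in> {a..b}") (auto simp: mult.commute[of _ "test_apply \<rho> x"] mult_left_mono)
    then show "ennreal (norm (test_apply \<rho> x *\<^sub>R g x)) \<le> ennreal \<eta> * ennreal (test_apply \<rho> x)"
      using \<eta> by (simp flip: ennreal_mult' add: ennreal_leI)
  qed
  also have "\<dots> = ennreal \<eta> * (\<integral>\<^sup>+x. ennreal (test_apply \<rho> x) \<partial>half_line)"
    using i(1) by (intro nn_integral_cmult) (auto intro: borel_measurable_integrable)
  also have "(\<integral>\<^sup>+x. ennreal (test_apply \<rho> x) \<partial>half_line) = ennreal 1"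
    using nn_integral_eq_integral[OF i(1)] \<rho>(1) i(2) by simp
  finally show "(\<integral>\<^sup>+x. ennreal (norm (test_apply \<rho> x *\<^sub>R g x)) \<partial>half_line) \<le> ennreal \<eta>"
    by simp
qed (fact \<eta>)

lemma norm_regular_distr_exp_ge:
  assumes \<rho>: "\<And>x. 0 \<le> test_apply \<rho> x" "\<And>x. x \<notin> {a..b} \<Longrightarrow> test_apply \<rho> x = 0"
      "integral {a..b} (test_apply \<rho>) = 1" and ab: "0 < a" "a \<le> b"
  shows "exp (- b) * norm c \<le> norm (regular_distr (\<lambda>x. exp (- x) *\<^sub>R c) \<rho>)"
proof -
  note i = integral_half_line_normalized[OF \<rho>(2,3) ab]
  have "integrable half_line (\<lambda>x. test_apply \<rho> x * exp (- x))"
    by (rule integral_half_line_compact_support(1)[where B = b])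
      (use \<rho>(2) ab in \<open>auto intro!: continuous_intros\<close>)
  then have "(\<integral>x. exp (- b) * test_apply \<rho> x \<partial>half_line) \<le> (\<integral>x. test_apply \<rho> x * exp (- x) \<partial>half_line)"
  proof (intro integral_mono)
    fix x
    show "exp (- b) * test_apply \<rho> x \<le> test_apply \<rho> x * exp (- x)"
      using \<rho>(1)[of x] \<rho>(2)[of x] by (cases "x \<in> {a..b}") (auto simp: mult.commute mult_left_mono)
  qed (use i in auto)
  then have "exp (- b) \<le> \<bar>\<integral>x. test_apply \<rho> x * exp (- x) \<partial>half_line\<bar>"
    using i(2) by simp
  then show ?thesis
    unfolding regular_distr_exp norm_scaleR by (rule mult_right_mono) simp
qed

text \<open>
  The distance from \<open>exp(-x) c\<close> to the domain is positive. Suppose that some \<open>U\<close> in the domain is too close. For a bump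
  \<open>\<rho>\<close> sufficiently near \<open>0\<close>, the average of \<open>\<partial>^k_bc U\<close> is small by continuity of its representative, which vanishes at \<open>0\<close>;
  the average of the difference is small by the trace bound; but the average of the derivative of \<open>exp(-x) c\<close> has norm
  at least \<open>exp(-1) \<parallel>c\<parallel>\<close> for every bump on \<open>[0, 1]\<close>.
\<close>

lemma sobolev_bc_not_dense:
  fixes bc :: bc and c :: "'a::banach"
  assumes p: "1 < p" and "-1 < \<gamma>" and \<gamma>: "\<gamma> < (real k - real (k_bc bc)) * p - 1" and c: "c \<noteq> 0"
  obtains T :: "'a distr" and e where "T \<in> sobolev k p \<gamma>" "0 < e"
    "\<And>U. U \<in> sobolev_bc bc (k + l) p \<gamma> \<Longrightarrow> e < sobolev_norm k p \<gamma> (T - U)"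
proof -
  define m where "m = k - k_bc bc"
  have "0 < (real k - real (k_bc bc)) * p" using assms(2) \<gamma> by simp
  then have lt: "k_bc bc < k" using p by (simp add: zero_less_mult_iff)
  then have k: "k = k_bc bc + m" and m: "0 < m" by (auto simp: m_def)
  have "\<gamma> + 1 < real m * p" using \<gamma> lt by (simp add: m_def of_nat_diff)
  then obtain L where L: "\<And>(T :: 'a distr) e \<rho>. T \<in> sobolev k p \<gamma> \<Longrightarrow> 0 < e \<Longrightarrow>
    sobolev_norm k p \<gamma> T \<le> e \<Longrightarrow> (\<And>x. 0 \<le> test_apply \<rho> x) \<Longrightarrow> (\<And>x. 1 < x \<Longrightarrow> test_apply \<rho> x = 0) \<Longrightarrow>
    integral {0..1} (test_apply \<rho>) \<le> 1 \<Longrightarrow> norm ((distr_deriv ^^ k_bc bc) T \<rho>) \<le> L * e"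
    using sobolev_trace_bound[OF p _ m, of \<gamma> "k_bc bc"] unfolding k by blast
  define T where "T = regular_distr (\<lambda>x. exp (- x) *\<^sub>R c)"
  have T: "T \<in> sobolev k p \<gamma>" unfolding T_def by (rule sobolev_exp[OF assms(2) p])
  \<comment> \<open>the trace bound and the continuity at \<open>0\<close> contribute at most \<open>\<delta>\<close> each, against the lower bound \<open>3 \<delta>\<close>\<close>
  define \<delta> where "\<delta> = exp (- 1) * norm c / 3"
  have \<delta>: "0 < \<delta>" using c by (simp add: \<delta>_def)
  define e where "e = \<delta> / (\<bar>L\<bar> + 1)"
  have e: "0 < e" using \<delta> by (simp add: e_def)
  have Le: "L * e \<le> \<delta>"
  proof -
    have "L * e \<le> (\<bar>L\<bar> + 1) * e" using e by (intro mult_right_mono) auto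
    then show ?thesis by (simp add: e_def)
  qed
  have "e < sobolev_norm k p \<gamma> (T - U)" if U: "U \<in> sobolev_bc bc (k + l) p \<gamma>" for U
  proof (rule ccontr)
    assume "\<not> e < sobolev_norm k p \<gamma> (T - U)"
    then have le: "sobolev_norm k p \<gamma> (T - U) \<le> e" by simp
    have "U \<in> sobolev k p \<gamma>" using U sobolev_mono[of k "k + l" p \<gamma>] by (auto simp: sobolev_bc_def)
    then have TU: "T - U \<in> sobolev k p \<gamma>" by (rule sobolev_diff[OF T _ p])
    obtain g where g: "continuous_on {0..} g" "(distr_deriv ^^ k_bc bc) U = regular_distr g" "g 0 = 0"
      using U by (auto simp: sobolev_bc_def has_trace_def)
    obtain d where d: "0 < d" "\<And>x. 0 \<le> x \<Longrightarrow> x < d \<Longrightarrow> norm (g x) < \<delta>"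
      using continuous_on_iff[THEN iffD1, OF g(1), rule_format, of 0 \<delta>] \<delta> g(3)
      by (auto simp: dist_norm)
    define b where "b = min (d / 2) 1"
    have b: "0 < b" "b < d" "b \<le> 1" using d by (auto simp: b_def)
    obtain \<rho> where \<rho>: "\<And>x. 0 \<le> test_apply \<rho> x" "\<And>x. x \<notin> {b/2..b} \<Longrightarrow> test_apply \<rho> x = 0"
        "integral {b/2..b} (test_apply \<rho>) = 1"
      using normalized_test_fun[of "b / 2" b] b by auto
    have b2: "0 < b / 2" "b / 2 \<le> b" using b by auto
    have "integral {0..1} (test_apply \<rho>) = 1"
      by (rule integral_half_line_normalized(3)[OF \<rho>(2,3) b2 b(3)])
    then have "norm ((distr_deriv ^^ k_bc bc) (T - U) \<rho>) \<le> L * e"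
      using \<rho> b by (intro L TU e le) auto
    moreover have "norm ((distr_deriv ^^ k_bc bc) U \<rho>) \<le> \<delta>"
      unfolding g(2) using d(2) b \<delta>
      by (intro norm_regular_distr_le_sup[OF \<rho> b2]) (auto intro!: less_imp_le)
    moreover have "3 * \<delta> \<le> norm ((distr_deriv ^^ k_bc bc) T \<rho>)"
    proof -
      have "exp (- 1) * norm c \<le> exp (- b) * norm c"
        using b by (intro mult_right_mono) auto
      also have "\<dots> \<le> norm ((distr_deriv ^^ k_bc bc) T \<rho>)"
        using norm_regular_distr_exp_ge[OF \<rho> b2, of "(- 1) ^ k_bc bc *\<^sub>R c"]
        unfolding T_def distr_deriv_funpow_exp by simp
      finally show ?thesis by (simp add: \<delta>_def)
    qed
    moreover have "norm ((distr_deriv ^^ k_bc bc) T \<rho>)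
        \<le> norm ((distr_deriv ^^ k_bc bc) (T - U) \<rho>) + norm ((distr_deriv ^^ k_bc bc) U \<rho>)"
      using norm_triangle_ineq[of "(distr_deriv ^^ k_bc bc) T \<rho> - (distr_deriv ^^ k_bc bc) U \<rho>"
          "(distr_deriv ^^ k_bc bc) U \<rho>"]
      by (simp add: distr_deriv_funpow_diff)
    ultimately show False using Le \<delta> by linarith
  qed
  with T e show ?thesis using that by blast
qed

theorem proposition4p1:
  fixes p \<gamma> lam :: real and k :: nat and bc :: bc
  assumes "1 < p"
    and "-1 < \<gamma>" and "\<gamma> < (real k - real (k_bc bc)) * p - 1"
    and "\<forall>j::nat. 1 \<le> j \<longrightarrow> \<gamma> \<noteq> real j * p - 1"
    and "UMD TYPE('a::complex_banach)" and "\<exists>x::'a. x \<noteq> 0"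
    and "0 < lam"
  shows "\<not> sectorial (sobolev k p \<gamma> :: 'a distr set) (sobolev_norm k p \<gamma>)
    (sobolev_bc bc (k + 2) p \<gamma>) (\<lambda>u. complex_of_real lam *\<^sub>C u - laplacian u)"
proof
  assume "sectorial (sobolev k p \<gamma> :: 'a distr set) (sobolev_norm k p \<gamma>)
    (sobolev_bc bc (k + 2) p \<gamma>) (\<lambda>u. complex_of_real lam *\<^sub>C u - laplacian u)"
  then have dense: "dense_in (sobolev k p \<gamma> :: 'a distr set) (sobolev_norm k p \<gamma>) (sobolev_bc bc (k + 2) p \<gamma>)"
    by (simp add: sectorial_def)
  obtain c :: 'a where "c \<noteq> 0" using assms(6) by blast
  then obtain T :: "'a distr" and e where "T \<in> sobolev k p \<gamma>" "0 < e"
    "\<And>U. U \<in> sobolev_bc bc (k + 2) p \<gamma> \<Longrightarrow> e < sobolev_norm k p \<gamma> (T - U)"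
    using sobolev_bc_not_dense[OF assms(1-3)] by metis
  with dense show False
    unfolding dense_in_def by (meson not_less_iff_gr_or_eq)
qed

end
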